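(* Let $M$ be a matroid of rank $d$ on $[n]$ ($1\le d\le n-1$), with rank function $\rho_M$. Then in $K^0_T(\mathrm{pt})[u,v]=\mathbb{Z}[t_1^{\pm1},\dots,t_n^{\pm1}][u,v]$, $$\int^T\sum_{p=0}^{d}\sum_{q=0}^{n-d}y(M)\,[\mathcal{O}(1)]^T\,[\textstyle\bigwedge^pS]^T\,[\bigwedge^q(Q^\vee)]^T\,u^pv^q=\sum_{S\subseteq[n]}t^{e_S}\,u^{d-\rho_M(S)}\,v^{|S|-\rho_M(S)}.$$
   Context: A matroid of rank $d$ on $[n]$ is given by its set $M\subseteq\binom{[n]}{d}$ of bases; $\rho_M(S)=\max_{I\in M}|S\cap I|$. For $I\subseteq[n]$, $e_I=\sum_{i\in I}e_i$ and $t^{e_I}=\prod_{i\in I}t_i$. For $I\in M$ let $\mathtt{Cone}_I(M)$ be the cone $\mathbb{R}_{\ge0}$-spanned by $e_J-e_I$, $J\in M$, and $\mathtt{Cone}_I(M)=\emptyset$ for $I\notin M$; $\mathrm{hilb}(C)=\sum_{a\in C\cap\mathbb{Z}^n}t^a$ as a rational function ($\mathrm{hilb}(\emptyset)=0$). Let $T=(\mathbb{C}^* )^n$ act on $\mathbb{C}^n$ by $(t\cdot x)_i=t_i^{-1}x_i$. By localization, $K^0_T(G(d,n))$ is the ring (pointwise operations) of functions $f:\binom{[n]}{d}\to\mathbb{Z}[t^{\pm1}]$ (value at the fixed point $x_I=\mathrm{span}(e_i:i\in I)$) with $f(S\cup\{i\})\equiv f(S\cup\{j\})\bmod(1-t_i^{-1}t_j)$.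 In this description, with $S$ the tautological subbundle and $Q=\mathbb{C}^n/S$: $[\mathcal{O}(1)]^T(I)=\prod_{i\in I}t_i$ (where $\mathcal{O}(1)=\bigwedge^dS^\vee$), $[\bigwedge^pS]^T(I)=e_p(t_i^{-1}:i\in I)$, $[\bigwedge^q(Q^\vee)]^T(I)=e_q(t_j:j\notin I)$, with $e_k$ the $k$-th elementary symmetric polynomial. The class $y(M)$ is $I\mapsto\mathrm{hilb}(\mathtt{Cone}_I(M))\prod_{i\in I}\prod_{j\notin I}(1-t_i^{-1}t_j)$. The equivariant pushforward to a point is $\int^Tf=\sum_{I\in\binom{[n]}{d}}f(I)\big/\prod_{i\in I}\prod_{j\notin I}(1-t_i^{-1}t_j)$. *)

theory Defs
  imports
    Complex_Main
    "HOL-Library.Indicator_Function"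
    "HOL-Library.Poly_Mapping"
    "HOL-Library.Function_Algebras"
    "HOL-Computational_Algebra.Polynomial_Factorial"
begin

text \<open>
  The ground set is \<open>{1..n}\<close>. Laurent polynomials are the group algebra over \<open>int\<close> of the
  finitely supported exponent vectors \<open>nat \<Rightarrow>\<^sub>0 int\<close>. This is the Laurent polynomial ring in
  variables indexed by all of \<open>nat\<close>; only the variables with index in \<open>{1..n}\<close> occur below.
\<close>

type_synonym expo = "nat \<Rightarrow>\<^sub>0 int"
type_synonym laurent = "expo \<Rightarrow>\<^sub>0 int"
type_synonym ratfun = "laurent fract"

definition tvar :: "nat \<Rightarrow> laurent" where
  "tvar i = Poly_Mapping.single (Poly_Mapping.single i 1) 1"

definition tvar_inv :: "nat \<Rightarrow> laurent" where
  "tvar_inv i = Poly_Mapping.single (Poly_Mapping.single i (- 1)) 1"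

lemma tvar_mult_inv: "tvar i * tvar_inv i = 1"
  by (simp add: tvar_def tvar_inv_def mult_single single_add [symmetric] flip: single_one)


definition is_matroid :: "nat \<Rightarrow> nat \<Rightarrow> nat set set \<Rightarrow> bool" where
  "is_matroid n d M \<longleftrightarrow>
     M \<noteq> {} \<and>
     (\<forall>I\<in>M. I \<subseteq> {1..n} \<and> card I = d) \<and>
     (\<forall>A\<in>M. \<forall>B\<in>M. \<forall>a\<in>A - B. \<exists>b\<in>B - A. insert b (A - {a}) \<in> M)"

definition rank_fn :: "nat set set \<Rightarrow> nat set \<Rightarrow> nat" where
  "rank_fn M S = Max ((\<lambda>I. card (S \<inter> I)) ` M)"


definition Cone :: "nat set set \<Rightarrow> nat set \<Rightarrow> (nat \<Rightarrow> real) set" where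
  "Cone M I =
     (if I \<in> M
      then {(\<lambda>k. \<Sum>J\<in>M. c J * (indicator J k - indicator I k)) | c. \<forall>J\<in>M. 0 \<le> c J}
      else {})"

definition lattice_point :: "(nat \<Rightarrow> real) set \<Rightarrow> expo \<Rightarrow> bool" where
  "lattice_point C a \<longleftrightarrow> (\<lambda>i. real_of_int (Poly_Mapping.lookup a i)) \<in> C"

text \<open>
  Laurent polynomials act by convolution on arbitrary formal sums \<open>\<Sum>a. s a * t^a\<close>, given by
  their coefficient functions \<open>s\<close>. The generating function of the lattice points of \<open>C\<close> sums
  to the rational function \<open>p / q\<close> if \<open>q \<noteq> 0\<close> and multiplication by \<open>q\<close> turns it into \<open>p\<close>.
  The rational function is then unique, whatever \<open>C\<close> is (\<open>has_hilb_unique\<close>).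
\<close>

definition laurent_act :: "laurent \<Rightarrow> (expo \<Rightarrow> int) \<Rightarrow> expo \<Rightarrow> int" where
  "laurent_act q s b = (\<Sum>m\<in>Poly_Mapping.keys q. Poly_Mapping.lookup q m * s (b - m))"

definition has_hilb :: "(nat \<Rightarrow> real) set \<Rightarrow> ratfun \<Rightarrow> bool" where
  "has_hilb C h \<longleftrightarrow>
     (\<exists>p q. q \<noteq> 0 \<and> laurent_act q (\<lambda>a. of_bool (lattice_point C a)) = Poly_Mapping.lookup p \<and>
            h = Fract p q)"

definition hilb :: "(nat \<Rightarrow> real) set \<Rightarrow> ratfun" where
  "hilb C = (THE h. has_hilb C h)"

lemma laurent_act_lookup: "laurent_act q (Poly_Mapping.lookup p) = Poly_Mapping.lookup (q * p)"
proof
  fix b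
  have "Poly_Mapping.lookup (q * p) b = (\<Sum>m\<in>Poly_Mapping.keys q. Poly_Mapping.lookup q m * (\<Sum>k. Poly_Mapping.lookup p k when b = m + k))"
    unfolding lookup_mult
    by (rule Sum_any.expand_superset) (auto simp: in_keys_iff)
  also have "\<dots> = (\<Sum>m\<in>Poly_Mapping.keys q. Poly_Mapping.lookup q m * Poly_Mapping.lookup p (b - m))"
  proof (intro sum.cong refl)
    fix m
    have "(\<lambda>k. Poly_Mapping.lookup p k when b = m + k) = (\<lambda>k. Poly_Mapping.lookup p k when k = b - m)"
      by (auto simp: fun_eq_iff when_def)
    then have "(\<Sum>k. Poly_Mapping.lookup p k when b = m + k) = Poly_Mapping.lookup p (b - m)"
      by (simp only: Sum_any_when_equal)
    then show "Poly_Mapping.lookup q m * (\<Sum>k. Poly_Mapping.lookup p k when b = m + k) =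
        Poly_Mapping.lookup q m * Poly_Mapping.lookup p (b - m)"
      by simp
  qed
  finally show "laurent_act q (Poly_Mapping.lookup p) b = Poly_Mapping.lookup (q * p) b"
    by (simp add: laurent_act_def)
qed

lemma laurent_act_commute: "laurent_act p (laurent_act q s) = laurent_act q (laurent_act p s)"
proof
  fix b
  show "laurent_act p (laurent_act q s) b = laurent_act q (laurent_act p s) b"
    unfolding laurent_act_def sum_distrib_left
    by (subst sum.swap) (simp add: algebra_simps diff_right_commute)
qed

lemma has_hilb_unique:
  assumes "has_hilb C h" "has_hilb C h'"
  shows "h = h'"
proof -
  let ?s = "\<lambda>a. of_bool (lattice_point C a) :: int"
  obtain p q where 1: "q \<noteq> 0" "laurent_act q ?s = Poly_Mapping.lookup p" "h = Fract p q"
    using assms(1) by (auto simp: has_hilb_def)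
  obtain p' q' where 2: "q' \<noteq> 0" "laurent_act q' ?s = Poly_Mapping.lookup p'" "h' = Fract p' q'"
    using assms(2) by (auto simp: has_hilb_def)
  have "Poly_Mapping.lookup (q' * p) = Poly_Mapping.lookup (q * p')"
    using laurent_act_commute[of q' q ?s] by (simp add: 1 2 laurent_act_lookup)
  then have "q' * p = q * p'"
    by (simp add: poly_mapping_eqI)
  then show ?thesis
    using 1 2 by (simp add: eq_fract mult.commute)
qed

lemma hilb_eqI: "has_hilb C h \<Longrightarrow> hilb C = h"
  unfolding hilb_def by (blast intro: has_hilb_unique)

lemma hilb_empty: "hilb {} = 0"
proof (rule hilb_eqI)
  have "laurent_act 1 (\<lambda>a. of_bool (lattice_point {} a)) = Poly_Mapping.lookup 0"
    by (simp add: lattice_point_def laurent_act_def fun_eq_iff)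
  then show "has_hilb {} 0"
    unfolding has_hilb_def Zero_fract_def using one_neq_zero by blast
qed


text \<open>
  A class is given by its values at the fixed points \<open>x\<^sub>I\<close>; the values at sets \<open>I\<close> that are not
  \<open>d\<close>-subsets of \<open>{1..n}\<close> are irrelevant, as \<open>pushforward\<close> ignores them. Ring operations on classes
  are pointwise. Both \<open>hilb\<close> and the localization formula produce rational functions, so all values
  are taken in the fraction field of the Laurent polynomial ring.
\<close>

type_synonym Kclass = "nat set \<Rightarrow> ratfun"

definition tangent_factor :: "nat \<Rightarrow> nat set \<Rightarrow> laurent" where
  "tangent_factor n I = (\<Prod>i\<in>I. \<Prod>j\<in>{1..n} - I. 1 - tvar_inv i * tvar j)"

definition elem_sym :: "nat \<Rightarrow> (nat \<Rightarrow> 'a::comm_ring_1) \<Rightarrow> nat set \<Rightarrow> 'a" where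
  "elem_sym k x A = (\<Sum>X | X \<subseteq> A \<and> card X = k. \<Prod>i\<in>X. x i)"

definition O1 :: Kclass where
  "O1 I = to_fract (\<Prod>i\<in>I. tvar i)"

definition wedge_S :: "nat \<Rightarrow> Kclass" where
  "wedge_S p I = to_fract (elem_sym p tvar_inv I)"

definition wedge_Qdual :: "nat \<Rightarrow> nat \<Rightarrow> Kclass" where
  "wedge_Qdual n q I = to_fract (elem_sym q tvar ({1..n} - I))"

definition y_class :: "nat \<Rightarrow> nat set set \<Rightarrow> Kclass" where
  "y_class n M I = hilb (Cone M I) * to_fract (tangent_factor n I)"

definition pushforward :: "nat \<Rightarrow> nat \<Rightarrow> Kclass \<Rightarrow> ratfun" where
  "pushforward n d f =
     (\<Sum>I | I \<subseteq> {1..n} \<and> card I = d. f I / to_fract (tangent_factor n I))"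


text \<open>
  \<open>R[u,v]\<close> is represented as \<open>R poly poly\<close>, with \<open>u\<close> the inner and \<open>v\<close> the outer variable.
  For \<open>f\<close> additive, \<open>map_coeffs f\<close> is the \<open>\<int>[u,v]\<close>-linear extension of \<open>f\<close>.
\<close>

definition uv_monom :: "'a::zero \<Rightarrow> nat \<Rightarrow> nat \<Rightarrow> 'a poly poly" where
  "uv_monom c p q = monom (monom c p) q"

definition map_coeffs :: "('a::zero \<Rightarrow> 'b::zero) \<Rightarrow> 'a poly poly \<Rightarrow> 'b poly poly" where
  "map_coeffs f = map_poly (map_poly f)"

end

theory Submission
  imports Defs "HOL-Combinatorics.Multiset_Permutations"
begin

text \<open>
  Formal sums of lattice points that are periodic in some direction are killed by a nonzero Laurent
  polynomial, so a cone containing a line has Hilbert series \<open>0\<close>. Hence the Hilbert series of a cone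
  is the sum of those of its extensions by two opposite rays. Comparing all pairs of coordinates in
  this way writes the series of \<open>Cone\<^sub>I(M)\<close> as the sum, over the total orders of the ground set, of the
  series of its sum with the cone spanned by the consecutive differences of the order. That sum
  contains a line unless \<open>I\<close> is the greedy basis of the order, in which case it is the unimodular cone
  of the order itself.

  The left-hand side thus becomes a sum over all orders in which each element contributes \<open>t + u\<close>
  where the rank jumps along the order and \<open>1 + v t\<close> where it does not. It is evaluated by
  induction: splitting off the last element of the order is Lagrange interpolation at the points \<open>t\<^sub>x\<close>.
\<close>

section \<open>Sums over total orders\<close>

lemma sum_permutations_of_set:
  fixes f :: "'a list \<Rightarrow> 'b::comm_monoid_add"
  assumes "finite V" and "V \<noteq> {}"
  shows "(\<Sum>w\<in>permutations_of_set V. f w) = (\<Sum>x\<in>V. \<Sum>w\<in>permutations_of_set (V - {x}). f (x # w))"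
proof -
  have "(\<Sum>w\<in>permutations_of_set V. f w)
      = (\<Sum>x\<in>V. \<Sum>w\<in>(#) x ` permutations_of_set (V - {x}). f w)"
    unfolding permutations_of_set_nonempty[OF assms(2)]
    by (rule sum.UNION_disjoint) (use assms in auto)
  also have "\<dots> = (\<Sum>x\<in>V. \<Sum>w\<in>permutations_of_set (V - {x}). f (x # w))"
    by (rule sum.cong) (auto simp: sum.reindex o_def)
  finally show ?thesis .
qed

section \<open>Top coefficients of products of linear polynomials\<close>

lemma coeff_mult_le_degree:
  assumes "degree p \<le> m" and "degree q \<le> n"
  shows "coeff (p * q) (m + n) = coeff p m * coeff q n"
proof -
  have "coeff (p * q) (m + n) = (\<Sum>i\<le>m + n. coeff p i * coeff q (m + n - i))"
    by (simp add: coeff_mult)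
  also have "\<dots> = (\<Sum>i\<in>{m}. coeff p i * coeff q (m + n - i))"
  proof (intro sum.mono_neutral_right ballI)
    fix i assume "i \<in> {..m + n} - {m}"
    then have "degree p < i \<or> degree q < m + n - i"
      using assms by auto
    then show "coeff p i * coeff q (m + n - i) = 0"
      by (auto simp: coeff_eq_0)
  qed auto
  finally show ?thesis by simp
qed

text \<open>A degree bound together with the coefficient at \<open>k\<close> replaces the exact
  degree, because \<open>b\<close> may vanish, as in the factor \<open>[:1, v:]\<close> for
  \<open>v = 0\<close>.\<close>

lemma coeff_linear_power:
  fixes a b :: "'a::comm_ring_1"
  shows "degree ([:a, b:] ^ k) \<le> k" and "coeff ([:a, b:] ^ k) k = b ^ k"
proof -
  have deg: "degree ([:a, b:] ^ j) \<le> j" for j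
    by (rule order_trans[OF degree_power_le]) auto
  then show "degree ([:a, b:] ^ k) \<le> k" .
  show "coeff ([:a, b:] ^ k) k = b ^ k"
  proof (induction k)
    case (Suc k)
    have "coeff ([:a, b:] * [:a, b:] ^ k) (1 + k) = coeff [:a, b:] 1 * coeff ([:a, b:] ^ k) k"
      by (rule coeff_mult_le_degree) (auto intro: deg)
    then show ?case by (simp add: Suc)
  qed simp
qed

lemma coeff_linear_prod:
  fixes a b :: "'b \<Rightarrow> 'a::comm_ring_1"
  assumes "finite S"
  shows "degree (\<Prod>x\<in>S. [:a x, b x:]) \<le> card S"
    and "coeff (\<Prod>x\<in>S. [:a x, b x:]) (card S) = (\<Prod>x\<in>S. b x)"
proof -
  have deg: "degree (\<Prod>x\<in>T. [:a x, b x:]) \<le> card T" if "finite T" for T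
    by (rule order_trans[OF degree_prod_sum_le[OF that]])
       (use sum_bounded_above[of T "\<lambda>x. degree [:a x, b x:]" 1] in \<open>auto simp: o_def\<close>)
  then show "degree (\<Prod>x\<in>S. [:a x, b x:]) \<le> card S"
    using assms .
  show "coeff (\<Prod>x\<in>S. [:a x, b x:]) (card S) = (\<Prod>x\<in>S. b x)"
    using assms
  proof (induction S)
    case (insert y S)
    have "coeff ([:a y, b y:] * (\<Prod>x\<in>S. [:a x, b x:])) (1 + card S)
        = coeff [:a y, b y:] 1 * coeff (\<Prod>x\<in>S. [:a x, b x:]) (card S)"
      by (rule coeff_mult_le_degree) (auto intro: deg insert)
    then show ?case using insert by simp
  qed simp
qed

text \<open>Lists enumerate a total order from its last element to its first.\<close>

fun chain_hilb :: "('a \<Rightarrow> 'b::field) \<Rightarrow> 'a list \<Rightarrow> 'b" where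
  "chain_hilb t (x # y # w) = chain_hilb t (y # w) / (1 - t x / t y)"
| "chain_hilb t _ = 1"

fun chain_weight :: "('a set \<Rightarrow> nat) \<Rightarrow> ('a \<Rightarrow> 'b) \<Rightarrow> 'b \<Rightarrow> 'b \<Rightarrow> 'a list \<Rightarrow> 'b::field" where
  "chain_weight \<rho> t u v [] = 1"
| "chain_weight \<rho> t u v (x # w) =
    (if \<rho> (insert x (set w)) = \<rho> (set w) then 1 + v * t x else t x + u) * chain_weight \<rho> t u v w"

text \<open>The sum over orders is evaluated for any function that starts at 0 and grows by 0 or 1
  with each new element. Matroid rank functions are an instance.\<close>

locale unit_rank =
  fixes \<rho> :: "'a set \<Rightarrow> nat"
  assumes rank_empty: "\<rho> {} = 0"
    and rank_insert: "finite S \<Longrightarrow> \<rho> (insert x S) = \<rho> S \<or> \<rho> (insert x S) = Suc (\<rho> S)"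
begin

lemma rank_Un: "finite B \<Longrightarrow> finite A \<Longrightarrow> \<rho> A \<le> \<rho> (A \<union> B) \<and> \<rho> (A \<union> B) \<le> \<rho> A + card B"
proof (induction B rule: finite_induct)
  case (insert x B)
  then show ?case
    using rank_insert[of "A \<union> B" x] by auto
qed simp

lemma rank_subset:
  assumes "finite S" and "B \<subseteq> S"
  shows "\<rho> B \<le> \<rho> S" and "\<rho> S - \<rho> B \<le> card S - card B"
proof -
  have fin: "finite B" using assms finite_subset by blast
  show "\<rho> B \<le> \<rho> S" "\<rho> S - \<rho> B \<le> card S - card B"
    using rank_Un[of "S - B" B] fin assms by (auto simp: Un_absorb1 card_Diff_subset)
qed

lemma rank_le_card: "finite B \<Longrightarrow> \<rho> B \<le> card B"
  using rank_Un[of B "{}"] rank_empty by simp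

text \<open>At \<open>z = 0\<close> this is the summand of \<open>B\<close> in the rank generating
  function. The exponents of \<open>u + z\<close> and \<open>1 + v z\<close> are the growth of rank
  and of nullity from \<open>B\<close> to \<open>S\<close>, so that every term gets the same degree
  bound \<open>card S\<close>.\<close>

definition rank_term :: "('a \<Rightarrow> 'b::field) \<Rightarrow> 'b \<Rightarrow> 'b \<Rightarrow> 'a set \<Rightarrow> 'a set \<Rightarrow> 'b poly" where
  "rank_term t u v S B = (\<Prod>x\<in>B. [:t x, -1:]) * [:v ^ (card B - \<rho> B):] * [:u, 1:] ^ (\<rho> S - \<rho> B) *
     [:1, v:] ^ ((card S - card B) - (\<rho> S - \<rho> B))"

text \<open>
  The constant coefficient of \<open>rank_poly\<close> is the rank generating function. The variable \<open>z\<close> is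
  inserted such that at \<open>z = t x\<close> all terms with \<open>x \<in> B\<close> vanish, which yields the recursion
  \<open>rank_poly_insert\<close>, while the coefficients of \<open>z ^ card S\<close> cancel.
\<close>

definition rank_poly :: "('a \<Rightarrow> 'b::field) \<Rightarrow> 'b \<Rightarrow> 'b \<Rightarrow> 'a set \<Rightarrow> 'b poly" where
  "rank_poly t u v S = (\<Sum>B\<in>Pow S. rank_term t u v S B)"

text \<open>The nullity of \<open>B\<close> and the growth of nullity from \<open>B\<close> to
  \<open>S\<close> add up to the nullity of \<open>S\<close>. Hence the top coefficient depends on
  \<open>B\<close> only through its sign.\<close>

lemma rank_term_degree:
  assumes "finite S" and "B \<subseteq> S"
  shows "degree (rank_term t u v S B) \<le> card S"
    and "coeff (rank_term t u v S B) (card S) = (-1) ^ card B * v ^ (card S - \<rho> S)"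
proof -
  have fin: "finite B" using assms finite_subset by blast
  define k l where "k = \<rho> S - \<rho> B" and "l = (card S - card B) - (\<rho> S - \<rho> B)"
  have kl: "card S = (card B + k) + l"
    using rank_subset[OF assms] card_mono[OF assms] by (simp add: k_def l_def)
  define p where "p = smult (v ^ (card B - \<rho> B)) (\<Prod>x\<in>B. [:t x, -1:])"
  note P = coeff_linear_prod[OF fin, of t "\<lambda>_. -1"]
  have p: "degree p \<le> card B" "coeff p (card B) = (-1) ^ card B * v ^ (card B - \<rho> B)"
    using P by (auto simp: p_def intro: order_trans[OF degree_smult_le])
  have pk: "degree (p * [:u, 1:] ^ k) \<le> card B + k"
    by (rule order_trans[OF degree_mult_le]) (intro add_mono p coeff_linear_power)
  have e: "rank_term t u v S B = (p * [:u, 1:] ^ k) * [:1, v:] ^ l"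
    by (simp add: rank_term_def k_def l_def p_def)
  show "degree (rank_term t u v S B) \<le> card S"
    unfolding e kl by (rule order_trans[OF degree_mult_le]) (intro add_mono pk coeff_linear_power)
  have "coeff (rank_term t u v S B) (card S) = (-1) ^ card B * v ^ (card B - \<rho> B) * v ^ l"
    unfolding e kl coeff_mult_le_degree[OF pk coeff_linear_power(1)]
      coeff_mult_le_degree[OF p(1) coeff_linear_power(1)] coeff_linear_power(2) p(2)
    by simp
  also have "\<dots> = (-1) ^ card B * v ^ (card S - \<rho> S)"
  proof -
    have "card B - \<rho> B + l = card S - \<rho> S"
      using rank_subset[OF assms] card_mono[OF assms] rank_le_card[OF fin] by (simp add: l_def)
    then show ?thesis by (simp add: mult.assoc flip: power_add)
  qed
  finally show "coeff (rank_term t u v S B) (card S) = (-1) ^ card B * v ^ (card S - \<rho> S)" .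
qed

lemma rank_poly_degree: "finite S \<Longrightarrow> degree (rank_poly t u v S) \<le> card S"
  unfolding rank_poly_def by (rule degree_sum_le) (auto intro: rank_term_degree)

text \<open>Summing the signs over all subsets expands \<open>(1 - 1) ^ card S\<close>, which is 0
  for nonempty \<open>S\<close>.\<close>

lemma rank_poly_top_coeff:
  assumes "finite S" and "S \<noteq> {}"
  shows "coeff (rank_poly t u v S) (card S) = 0"
proof -
  have "coeff (rank_poly t u v S) (card S) = (\<Sum>B\<in>Pow S. (-1) ^ card B * v ^ (card S - \<rho> S))"
    unfolding rank_poly_def coeff_sum by (intro sum.cong refl rank_term_degree(2)) (use assms in auto)
  also have "\<dots> = (\<Prod>x\<in>S. 1 - 1) * v ^ (card S - \<rho> S)"
    using prod_diff_conv_sum[OF assms(1), of "\<lambda>_. 1::'b" "\<lambda>_. 1"] by (simp add: sum_distrib_right)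
  finally show ?thesis using assms by (simp add: card_gt_0_iff)
qed

text \<open>The factor \<open>t x - z\<close> removes the sets containing \<open>x\<close>. For the
  other sets, enlarging \<open>S\<close> by \<open>x\<close> raises the exponent of
  \<open>1 + v z\<close> if the rank stays and that of \<open>u + z\<close> if it jumps.\<close>

lemma rank_poly_insert:
  assumes "finite S" and "x \<notin> S"
  shows "poly (rank_poly t u v (insert x S)) (t x)
     = (if \<rho> (insert x S) = \<rho> S then 1 + v * t x else t x + u) * poly (rank_poly t u v S) (t x)"
    (is "_ = ?n * _")
proof -
  have "poly (rank_poly t u v (insert x S)) (t x)
      = (\<Sum>B\<in>Pow (insert x S). poly (rank_term t u v (insert x S) B) (t x))"
    by (simp add: rank_poly_def poly_sum)
  also have "\<dots> = (\<Sum>B\<in>Pow S. poly (rank_term t u v (insert x S) B) (t x))"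
  proof (rule sum.mono_neutral_right)
    show "\<forall>B\<in>Pow (insert x S) - Pow S. poly (rank_term t u v (insert x S) B) (t x) = 0"
    proof
      fix B assume "B \<in> Pow (insert x S) - Pow S"
      then have "x \<in> B" "finite B" using assms finite_subset by auto
      then have "(\<Prod>y\<in>B. t y - t x) = 0" by (intro prod_zero) auto
      then show "poly (rank_term t u v (insert x S) B) (t x) = 0"
        by (simp add: rank_term_def poly_prod)
    qed
  qed (use assms in auto)
  also have "\<dots> = (\<Sum>B\<in>Pow S. ?n * poly (rank_term t u v S B) (t x))"
  proof (intro sum.cong refl)
    fix B assume "B \<in> Pow S"
    then have B: "B \<subseteq> S" by simp
    note r = rank_subset[OF assms(1) B] card_mono[OF assms(1) B]
    show "poly (rank_term t u v (insert x S) B) (t x) = ?n * poly (rank_term t u v S B) (t x)"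
    proof (cases "\<rho> (insert x S) = \<rho> S")
      case True
      then have "(card (insert x S) - card B) - (\<rho> (insert x S) - \<rho> B)
          = Suc ((card S - card B) - (\<rho> S - \<rho> B))"
        using r assms by simp
      then show ?thesis using True by (simp add: rank_term_def algebra_simps)
    next
      case False
      then have "\<rho> (insert x S) = Suc (\<rho> S)" using rank_insert[OF assms(1), of x] by simp
      then have "(card (insert x S) - card B) - (\<rho> (insert x S) - \<rho> B)
          = (card S - card B) - (\<rho> S - \<rho> B)" "\<rho> (insert x S) - \<rho> B = Suc (\<rho> S - \<rho> B)"
        using r assms by simp_all
      then show ?thesis using False by (simp add: rank_term_def algebra_simps)
    qed
  qed
  finally show ?thesis by (simp add: rank_poly_def poly_sum sum_distrib_left)
qed

text \<open>
  By \<open>chain_poly_insert\<close>, the value at \<open>t x\<close> of this polynomial of degree less than \<open>card S\<close> sees only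
  the orders with last element \<open>x\<close>.
\<close>

definition chain_poly :: "('a \<Rightarrow> 'b::field) \<Rightarrow> 'b \<Rightarrow> 'b \<Rightarrow> 'a set \<Rightarrow> 'b poly" where
  "chain_poly t u v S = (\<Sum>w\<in>permutations_of_set S.
     smult (chain_hilb t w * chain_weight \<rho> t u v w) (\<Prod>x\<in>S - {hd w}. [:1, - (1 / t x):]))"

text \<open>Leaving out the factor of the last element \<open>hd w\<close> is what brings the degree
  below \<open>card S\<close>.\<close>

lemma chain_poly_degree:
  assumes "finite S" and "S \<noteq> {}"
  shows "degree (chain_poly t u v S) < card S"
  unfolding chain_poly_def
proof (rule degree_sum_less)
  show "card S > 0" using assms by (simp add: card_gt_0_iff)
  fix w assume "w \<in> permutations_of_set S"
  then have "hd w \<in> S" using assms by (metis permutations_of_setD(1) hd_in_set set_empty)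
  then have "card (S - {hd w}) < card S" using assms by (intro psubset_card_mono) auto
  moreover have "degree (\<Prod>x\<in>S - {hd w}. [:1, - (1 / t x):]) \<le> card (S - {hd w})"
    using assms by (intro coeff_linear_prod) auto
  ultimately show "degree (smult (chain_hilb t w * chain_weight \<rho> t u v w)
      (\<Prod>x\<in>S - {hd w}. [:1, - (1 / t x):])) < card S"
    by (meson degree_smult_le le_less_trans)
qed

text \<open>An order with another last element contributes the factor \<open>1 - z / t x\<close>,
  which vanishes at \<open>z = t x\<close>. For an order ending in \<open>x\<close> with
  \<open>y\<close> just before it, the denominator \<open>1 - t x / t y\<close> of
  \<open>chain_hilb\<close> cancels the factor of \<open>y\<close>, leaving the product that belongs
  to the shorter order.\<close>

lemma chain_poly_insert:
  assumes "finite S" and "x \<notin> S" and "inj_on t (insert x S)" and "\<And>y. y \<in> insert x S \<Longrightarrow> t y \<noteq> 0"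
  shows "poly (chain_poly t u v (insert x S)) (t x)
     = (if \<rho> (insert x S) = \<rho> S then 1 + v * t x else t x + u) * poly (chain_poly t u v S) (t x)"
    (is "_ = ?n * _")
proof -
  let ?g = "\<lambda>w. chain_hilb t w * chain_weight \<rho> t u v w * (\<Prod>y\<in>insert x S - {hd w}. 1 - t x / t y)"
  have "poly (chain_poly t u v (insert x S)) (t x) = (\<Sum>w\<in>permutations_of_set (insert x S). ?g w)"
    by (simp add: chain_poly_def poly_sum poly_prod)
  also have "\<dots> = (\<Sum>z\<in>insert x S. \<Sum>w\<in>permutations_of_set (insert x S - {z}). ?g (z # w))"
    by (rule sum_permutations_of_set) (use assms in auto)
  also have "\<dots> = (\<Sum>z\<in>{x}. \<Sum>w\<in>permutations_of_set (insert x S - {z}). ?g (z # w))"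
  proof (rule sum.mono_neutral_right)
    show "\<forall>z\<in>insert x S - {x}. (\<Sum>w\<in>permutations_of_set (insert x S - {z}). ?g (z # w)) = 0"
    proof (intro ballI sum.neutral)
      fix z w assume "z \<in> insert x S - {x}"
      then have "(\<Prod>y\<in>insert x S - {z}. 1 - t x / t y) = 0"
        using assms by (intro prod_zero) (auto intro!: bexI[of _ x])
      then show "?g (z # w) = 0" by simp
    qed
  qed (use assms in auto)
  also have "\<dots> = (\<Sum>w\<in>permutations_of_set S. ?g (x # w))"
    using assms(2) by simp
  also have "\<dots> = (\<Sum>w\<in>permutations_of_set S. ?n * (chain_hilb t w * chain_weight \<rho> t u v w *
      (\<Prod>y\<in>S - {hd w}. 1 - t x / t y)))"
  proof (intro sum.cong refl)
    fix w assume w: "w \<in> permutations_of_set S"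
    note set_w = permutations_of_setD(1)[OF w]
    define n where "n = ?n"
    have "?g (x # w) = n * (chain_hilb t w * chain_weight \<rho> t u v w * (\<Prod>y\<in>S - {hd w}. 1 - t x / t y))"
    proof (cases w)
      \<comment> \<open>Here \<open>S\<close> is empty, so the value of \<open>hd []\<close> does
        not affect the product.\<close>
      case Nil
      then show ?thesis using set_w by (auto simp: n_def)
    next
      case (Cons y w')
      then have y: "y \<in> S" using set_w by auto
      have nz: "t x \<noteq> t y" "t y \<noteq> 0" using y assms by (auto dest: inj_onD)
      have "(\<Prod>y\<in>S. 1 - t x / t y) = (1 - t x / t y) * (\<Prod>y\<in>S - {y}. 1 - t x / t y)"
        using y assms by (intro prod.remove) auto
      moreover have "insert x S - {x} = S" using assms by auto
      ultimately have "(\<Prod>y\<in>insert x S - {hd (x # w)}. 1 - t x / t y)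
          = (1 - t x / t y) * (\<Prod>y\<in>S - {hd w}. 1 - t x / t y)"
        using Cons by simp
      moreover have "chain_hilb t (x # w) = chain_hilb t w / (1 - t x / t y)"
        using Cons by simp
      moreover have "chain_weight \<rho> t u v (x # w) = n * chain_weight \<rho> t u v w"
        using set_w by (simp add: n_def)
      ultimately show ?thesis using nz by (simp del: chain_hilb.simps chain_weight.simps)
    qed
    then show "?g (x # w) = ?n * (chain_hilb t w * chain_weight \<rho> t u v w * (\<Prod>y\<in>S - {hd w}. 1 - t x / t y))"
      by (simp only: n_def)
  qed
  finally show ?thesis
    by (simp add: chain_poly_def poly_sum poly_prod sum_distrib_left)
qed

text \<open>Lagrange interpolation: both polynomials have degree at most \<open>card S\<close>, the
  same coefficient there, and the same values at the \<open>card S\<close> distinct points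
  \<open>t x\<close>. The values agree by induction because both satisfy the same recursion. Since
  that recursion evaluates at \<open>t x\<close>, the induction has to compare polynomials and not
  only their values at 0.\<close>

lemma chain_poly_eq_rank_poly:
  assumes "finite S" and "inj_on t S" and "\<And>x. x \<in> S \<Longrightarrow> t x \<noteq> 0"
  shows "chain_poly t u v S = rank_poly t u v S"
  using assms
proof (induction "card S" arbitrary: S rule: less_induct)
  case less
  show ?case
  proof (cases "S = {}")
    case True
    then show ?thesis
      by (simp add: chain_poly_def rank_poly_def rank_term_def rank_empty)
  next
    case False
    show ?thesis
    proof (rule poly_eqI_degree_lead_coeff)
      show "coeff (chain_poly t u v S) (card S) = coeff (rank_poly t u v S) (card S)"
        using rank_poly_top_coeff[OF less.prems(1) False, of t u v] coeff_eq_0[OF chain_poly_degree[OF less.prems(1) False, of t u v]]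
        by simp
      show "card (t ` S) \<ge> card S" using less.prems by (simp add: card_image)
      show "degree (chain_poly t u v S) \<le> card S" "degree (rank_poly t u v S) \<le> card S"
        using rank_poly_degree[OF less.prems(1), of t u v] chain_poly_degree[OF less.prems(1) False, of t u v]
        by (simp_all add: less_imp_le)
      fix z assume "z \<in> t ` S"
      then obtain x where x: "x \<in> S" "z = t x" by auto
      define S' where "S' = S - {x}"
      have S': "S = insert x S'" "x \<notin> S'" "finite S'" using x less.prems by (auto simp: S'_def)
      have "chain_poly t u v S' = rank_poly t u v S'"
        using less.prems S' by (intro less.hyps) (auto simp: inj_on_def)
      then show "poly (chain_poly t u v S) z = poly (rank_poly t u v S) z"
        using chain_poly_insert[OF S'(3,2), of t u v] rank_poly_insert[OF S'(3,2), of t u v] less.prems S'(1) x(2)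
        by simp
    qed
  qed
qed

theorem sum_chain_weight:
  assumes "finite S" and "inj_on t S" and "\<And>x. x \<in> S \<Longrightarrow> t x \<noteq> 0"
  shows "(\<Sum>w\<in>permutations_of_set S. chain_hilb t w * chain_weight \<rho> t u v w)
     = (\<Sum>B\<in>Pow S. (\<Prod>x\<in>B. t x) * u ^ (\<rho> S - \<rho> B) * v ^ (card B - \<rho> B))"
proof -
  have "(\<Sum>w\<in>permutations_of_set S. chain_hilb t w * chain_weight \<rho> t u v w) = poly (chain_poly t u v S) 0"
    by (simp add: chain_poly_def poly_sum poly_prod)
  also have "\<dots> = poly (rank_poly t u v S) 0"
    using assms by (simp add: chain_poly_eq_rank_poly)
  also have "\<dots> = (\<Sum>B\<in>Pow S. (\<Prod>x\<in>B. t x) * u ^ (\<rho> S - \<rho> B) * v ^ (card B - \<rho> B))"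
    unfolding rank_poly_def poly_sum
    by (intro sum.cong refl) (simp add: rank_term_def poly_prod mult_ac)
  finally show ?thesis .
qed

end

section \<open>Formal sums of lattice points\<close>

lemma laurent_act_add_left: "laurent_act (p + q) s = laurent_act p s + laurent_act q s"
proof
  fix b
  let ?K = "Poly_Mapping.keys p \<union> Poly_Mapping.keys q"
  have act: "laurent_act r s b = (\<Sum>m\<in>?K. Poly_Mapping.lookup r m * s (b - m))"
    if "Poly_Mapping.keys r \<subseteq> ?K" for r
    unfolding laurent_act_def by (rule sum.mono_neutral_left) (use that in \<open>auto simp: in_keys_iff\<close>)
  show "laurent_act (p + q) s b = (laurent_act p s + laurent_act q s) b"
    using Poly_Mapping.keys_add[of p q]
    by (simp add: act lookup_add distrib_right sum.distrib)
qed

lemma laurent_act_single: "laurent_act (Poly_Mapping.single m c) s b = c * s (b - m)"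
  by (simp add: laurent_act_def)

lemma laurent_act_zero_left [simp]: "laurent_act 0 s = 0"
  by (simp add: laurent_act_def fun_eq_iff)

lemma laurent_act_add_right: "laurent_act q (s + s') = laurent_act q s + laurent_act q s'"
  by (simp add: laurent_act_def fun_eq_iff distrib_left sum.distrib)

lemma laurent_act_diff_right: "laurent_act q (s - s') = laurent_act q s - laurent_act q s'"
  by (simp add: laurent_act_def fun_eq_iff right_diff_distrib sum_subtractf)

text \<open>Additivity in both polynomials reduces the claim to monomials, which act by scaled
  translations.\<close>

lemma laurent_act_mult: "laurent_act (p * q) s = laurent_act p (laurent_act q s)"
proof (induction p rule: Poly_Mapping.update_induct)
  case const
  show ?case by simp
next
  case (update p m c)
  have upd: "Poly_Mapping.update m c p = p + Poly_Mapping.single m c"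
    using update by (intro poly_mapping_eqI) (auto simp: lookup_update lookup_add lookup_single in_keys_iff when_def)
  have single: "laurent_act (Poly_Mapping.single m c * q) s = laurent_act (Poly_Mapping.single m c) (laurent_act q s)"
  proof (induction q rule: Poly_Mapping.update_induct)
    case const
    show ?case by (simp add: laurent_act_def fun_eq_iff)
  next
    case (update q k d)
    have "Poly_Mapping.update k d q = q + Poly_Mapping.single k d"
      using update by (intro poly_mapping_eqI) (auto simp: lookup_update lookup_add lookup_single in_keys_iff when_def)
    then show ?case
      using update
      by (auto simp: distrib_left laurent_act_add_left laurent_act_add_right mult_single laurent_act_single
          fun_eq_iff algebra_simps)
  qed
  then show ?case
    using update by (simp add: upd distrib_right laurent_act_add_left)
qed

text \<open>Extends \<open>has_hilb\<close> from indicator series to arbitrary coefficient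
  functions, so that sums and differences of series of cones can be treated.\<close>

definition has_gf :: "(expo \<Rightarrow> int) \<Rightarrow> ratfun \<Rightarrow> bool" where
  "has_gf s h \<longleftrightarrow> (\<exists>p q. q \<noteq> 0 \<and> laurent_act q s = Poly_Mapping.lookup p \<and> h = Fract p q)"

definition lattice_series :: "(nat \<Rightarrow> real) set \<Rightarrow> expo \<Rightarrow> int" where
  "lattice_series C a = of_bool (lattice_point C a)"

lemma has_hilb_eq: "has_hilb C h \<longleftrightarrow> has_gf (lattice_series C) h"
  by (simp add: has_hilb_def has_gf_def lattice_series_def[abs_def])

lemma has_gf_lookup: "has_gf (Poly_Mapping.lookup p) (to_fract p)"
  unfolding has_gf_def to_fract_def
  by (rule exI[of _ p], rule exI[of _ 1]) (simp add: laurent_act_lookup)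

lemma has_gf_act:
  assumes "has_gf (laurent_act q s) h" and "q \<noteq> 0"
  shows "has_gf s (h / to_fract q)"
proof -
  obtain p r where r: "r \<noteq> 0" "laurent_act r (laurent_act q s) = Poly_Mapping.lookup p" "h = Fract p r"
    using assms by (auto simp: has_gf_def)
  then show ?thesis
    unfolding has_gf_def using assms(2)
    by (intro exI[of _ p] exI[of _ "r * q"]) (simp add: laurent_act_mult Fract_conv_to_fract)
qed

lemma has_gf_add:
  assumes "has_gf s h" and "has_gf s' h'"
  shows "has_gf (s + s') (h + h')"
proof -
  obtain p q where 1: "q \<noteq> 0" "laurent_act q s = Poly_Mapping.lookup p" "h = Fract p q"
    using assms(1) by (auto simp: has_gf_def)
  obtain p' q' where 2: "q' \<noteq> 0" "laurent_act q' s' = Poly_Mapping.lookup p'" "h' = Fract p' q'"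
    using assms(2) by (auto simp: has_gf_def)
  have "laurent_act (q * q') (s + s') = laurent_act q' (laurent_act q s) + laurent_act q (laurent_act q' s')"
    by (simp add: laurent_act_add_right laurent_act_mult laurent_act_commute[of q q'])
  also have "\<dots> = Poly_Mapping.lookup (p * q' + p' * q)"
    by (simp add: 1 2 laurent_act_lookup fun_eq_iff lookup_add mult.commute)
  finally show ?thesis
    unfolding has_gf_def using 1 2
    by (intro exI[of _ "p * q' + p' * q"] exI[of _ "q * q'"]) simp
qed

lemma has_gf_zero: "has_gf 0 0"
proof -
  have "Poly_Mapping.lookup (0 :: laurent) = 0" by (simp add: fun_eq_iff)
  then show ?thesis using has_gf_lookup[of 0] by simp
qed

lemma has_gf_sum: "(\<And>i. i \<in> A \<Longrightarrow> has_gf (s i) (h i)) \<Longrightarrow> has_gf (\<Sum>i\<in>A. s i) (\<Sum>i\<in>A. h i)"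
  by (induction A rule: infinite_finite_induct) (auto intro: has_gf_zero has_gf_add)

text \<open>The torsion elements of the module of formal sums. The decompositions of cones below are
  congruences modulo these.\<close>

definition null_gf :: "(expo \<Rightarrow> int) \<Rightarrow> bool" where
  "null_gf s \<longleftrightarrow> (\<exists>q. q \<noteq> 0 \<and> laurent_act q s = 0)"

lemma null_gf_iff: "null_gf s \<longleftrightarrow> has_gf s 0"
proof -
  have zero: "(0 :: expo \<Rightarrow> int) = Poly_Mapping.lookup (0 :: laurent)" by (simp add: fun_eq_iff)
  show ?thesis
  proof
    assume "null_gf s"
    then show "has_gf s 0"
      unfolding null_gf_def has_gf_def zero by (force simp: Fract_conv_to_fract)
  next
    assume "has_gf s 0"
    then obtain p q where "q \<noteq> 0" "laurent_act q s = Poly_Mapping.lookup p" "p = 0"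
      unfolding has_gf_def by (auto simp: Fract_conv_to_fract)
    then show "null_gf s"
      using zero by (auto simp: null_gf_def)
  qed
qed

lemma laurent_act_zero_right [simp]: "laurent_act q 0 = 0"
  by (simp add: laurent_act_def fun_eq_iff)

lemma null_gf_zero [simp]: "null_gf 0"
  using has_gf_zero by (simp add: null_gf_iff)

lemma null_gf_eqI: "s = s' \<Longrightarrow> null_gf (s - s')"
  by simp

lemma null_gf_add: "null_gf s \<Longrightarrow> null_gf s' \<Longrightarrow> null_gf (s + s')"
  using has_gf_add[of s 0 s' 0] by (simp add: null_gf_iff)

lemma null_gf_diff: "null_gf s \<Longrightarrow> null_gf s' \<Longrightarrow> null_gf (s - s')"
  using null_gf_add[of s "0 - s'"] laurent_act_diff_right[of _ 0 s'] by (auto simp: null_gf_def)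

lemma has_gf_null: "null_gf (s - s') \<Longrightarrow> has_gf s' h \<Longrightarrow> has_gf s h"
  using has_gf_add[of "s - s'" 0 s' h] by (simp add: null_gf_iff)

lemma null_gf_sum: "(\<And>i. i \<in> A \<Longrightarrow> null_gf (s i - s' i)) \<Longrightarrow> null_gf (sum s A - sum s' A)"
  using has_gf_sum[of A "\<lambda>i. s i - s' i" "\<lambda>_. 0"] by (simp add: null_gf_iff sum_subtractf)

text \<open>The polynomial \<open>1 - t^m\<close> kills such a series, and it is nonzero because its
  constant coefficient is 1.\<close>

lemma null_gf_periodic:
  assumes "m \<noteq> 0" and "\<And>a. s (a - m) = s a"
  shows "null_gf s"
proof -
  let ?q = "1 - Poly_Mapping.single m 1 :: laurent"
  have "laurent_act ?q s = 0"
    using laurent_act_add_left[of ?q "Poly_Mapping.single m 1" s] assms(2)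
    by (auto simp: fun_eq_iff laurent_act_single simp flip: single_one)
  moreover have "?q \<noteq> 0"
  proof
    assume "?q = 0"
    then have "Poly_Mapping.lookup ?q 0 = 0" by simp
    then show False using assms(1) by (simp add: lookup_minus lookup_single)
  qed
  ultimately show ?thesis
    using has_gf_act[of ?q s 0] has_gf_zero by (simp add: null_gf_iff)
qed

section \<open>Convex cones spanned by a set of generators\<close>

inductive_set conic :: "('a \<Rightarrow> real) set \<Rightarrow> ('a \<Rightarrow> real) set" for G where
  zero: "0 \<in> conic G"
| step: "a \<in> conic G \<Longrightarrow> g \<in> G \<Longrightarrow> 0 \<le> c \<Longrightarrow> a + (\<lambda>k. c * g k) \<in> conic G"

lemma conic_add: "b \<in> conic G \<Longrightarrow> a \<in> conic G \<Longrightarrow> a + b \<in> conic G"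
  by (induction rule: conic.induct) (auto simp: add.assoc[symmetric] intro: conic.intros)

lemma conic_scale: "a \<in> conic G \<Longrightarrow> 0 \<le> c \<Longrightarrow> (\<lambda>k. c * a k) \<in> conic G"
proof (induction rule: conic.induct)
  case zero
  then show ?case using conic.zero[of G] by (simp add: zero_fun_def)
next
  case (step a g d)
  then have "(\<lambda>k. c * a k) + (\<lambda>k. (c * d) * g k) \<in> conic G"
    by (intro conic.step) auto
  then show ?case by (simp add: plus_fun_def algebra_simps)
qed

lemma conic_gen: "g \<in> G \<Longrightarrow> g \<in> conic G"
  using conic.step[OF conic.zero, of g G 1] by simp

lemma conic_least: "G \<subseteq> conic H \<Longrightarrow> conic G \<subseteq> conic H"
proof
  fix a assume "a \<in> conic G" "G \<subseteq> conic H"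
  then show "a \<in> conic H"
    by (induction rule: conic.induct) (auto intro: conic.zero conic_add conic_scale)
qed

lemma conic_mono: "G \<subseteq> H \<Longrightarrow> conic G \<subseteq> conic H"
  by (intro conic_least) (auto intro: conic_gen)

lemma conic_eqI: "G \<subseteq> conic H \<Longrightarrow> H \<subseteq> conic G \<Longrightarrow> conic G = conic H"
  by (intro equalityI conic_least)

lemma conic_insertE:
  assumes "a \<in> conic (insert v G)"
  obtains b c where "b \<in> conic G" "0 \<le> c" "a = b + (\<lambda>k. c * v k)"
  using assms
proof (induction arbitrary: thesis rule: conic.induct)
  case zero
  show ?case by (rule zero[of 0 0, OF conic.zero]) (auto simp: fun_eq_iff)
next
  case (step a g d)
  obtain b c where b: "b \<in> conic G" "0 \<le> c" "a = b + (\<lambda>k. c * v k)"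
    using step.IH by blast
  show ?case
  proof (cases "g = v")
    case True
    then show ?thesis
      using b step.hyps by (intro step.prems[of b "c + d"]) (auto simp: fun_eq_iff algebra_simps)
  next
    case False
    then have "b + (\<lambda>k. d * g k) \<in> conic G"
      using b step.hyps by (intro conic.step) auto
    then show ?thesis
      using b by (intro step.prems[of "b + (\<lambda>k. d * g k)" c]) (simp_all only: add_ac)
  qed
qed

lemma conic_insertI: "b \<in> conic G \<Longrightarrow> 0 \<le> c \<Longrightarrow> b + (\<lambda>k. c * v k) \<in> conic (insert v G)"
  by (rule conic.step) (use conic_mono[of G "insert v G"] in auto)

section \<open>Lattice points of cones modulo cones containing a line\<close>

definition real_expo :: "expo \<Rightarrow> nat \<Rightarrow> real" where
  "real_expo a = (\<lambda>i. real_of_int (Poly_Mapping.lookup a i))"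

lemma real_expo_diff: "real_expo (a - b) = real_expo a - real_expo b"
  by (simp add: real_expo_def fun_eq_iff lookup_minus)

lemma lattice_series_eq: "lattice_series C a = of_bool (real_expo a \<in> C)"
  by (simp add: lattice_series_def lattice_point_def real_expo_def)

text \<open>Such a cone is invariant under translation by the lattice vector \<open>m\<close>, so
  its series is periodic.\<close>

lemma null_gf_line:
  assumes "real_expo m \<in> conic G" and "- real_expo m \<in> conic G" and "m \<noteq> 0"
  shows "null_gf (lattice_series (conic G))"
proof (rule null_gf_periodic[OF assms(3)])
  fix a
  have "real_expo (a - m) \<in> conic G \<longleftrightarrow> real_expo a \<in> conic G"
    using conic_add[OF assms(1), of "real_expo (a - m)"] conic_add[OF assms(2), of "real_expo a"]
    by (auto simp: real_expo_diff)
  then show "lattice_series (conic G) (a - m) = lattice_series (conic G) a"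
    by (simp add: lattice_series_eq)
qed

text \<open>
  Modulo cones containing a line, a cone is the sum of its extensions by two opposite rays: the
  extensions cover the extension by the whole line and, by convexity, meet in the given cone.
\<close>

lemma null_gf_flip:
  assumes "m \<noteq> 0"
  shows "null_gf (lattice_series (conic G) - (lattice_series (conic (insert (real_expo m) G))
    + lattice_series (conic (insert (- real_expo m) G))))"
proof -
  let ?P = "conic (insert (real_expo m) G)" and ?N = "conic (insert (- real_expo m) G)"
  let ?L = "conic (insert (real_expo m) (insert (- real_expo m) G))"
  have sub: "?P \<subseteq> ?L" "?N \<subseteq> ?L" "conic G \<subseteq> ?P" "conic G \<subseteq> ?N"
    by (intro conic_mono; blast)+
  have un: "a \<in> ?P \<or> a \<in> ?N" if "a \<in> ?L" for a
  proof -
    obtain b c where b: "b \<in> ?N" "0 \<le> c" "a = b + (\<lambda>k. c * real_expo m k)"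
      using \<open>a \<in> ?L\<close> by (rule conic_insertE)
    obtain b' c' where b': "b' \<in> conic G" "0 \<le> c'" "b = b' + (\<lambda>k. c' * (- real_expo m) k)"
      using b(1) by (rule conic_insertE)
    have "a = b' + (\<lambda>k. (c - c') * real_expo m k)" "a = b' + (\<lambda>k. (c' - c) * (- real_expo m) k)"
      using b b' by (auto simp: fun_eq_iff algebra_simps)
    then show ?thesis
      using conic_insertI[OF b'(1), of "c - c'" "real_expo m"] conic_insertI[OF b'(1), of "c' - c" "- real_expo m"]
      by (cases "c' \<le> c") auto
  qed
  have int: "a \<in> conic G" if "a \<in> ?P" "a \<in> ?N" for a
  proof -
    obtain b c where b: "b \<in> conic G" "0 \<le> c" "a = b + (\<lambda>k. c * real_expo m k)"
      using \<open>a \<in> ?P\<close> by (rule conic_insertE)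
    obtain b' c' where b': "b' \<in> conic G" "0 \<le> c'" "a = b' + (\<lambda>k. c' * (- real_expo m) k)"
      using \<open>a \<in> ?N\<close> by (rule conic_insertE)
    show ?thesis
    proof (cases "c + c' = 0")
      case True
      then have "c = 0" using b b' by linarith
      then show ?thesis using b by (simp add: plus_fun_def)
    next
      case False
      then have pos: "0 < c + c'" using b b' by linarith
      \<comment> \<open>The point \<open>b\<close> is \<open>a\<close> shifted by
        \<open>-c m\<close> and \<open>b'\<close> is \<open>a\<close> shifted by
        \<open>c' m\<close>; these weights make the shifts cancel.\<close>
      have "(\<lambda>k. c' / (c + c') * b k) + (\<lambda>k. c / (c + c') * b' k) \<in> conic G"
        using b b' pos by (intro conic_add conic_scale) auto
      moreover have "a k = c' / (c + c') * b k + c / (c + c') * b' k" for k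
      proof -
        have "b k = a k - c * real_expo m k" "b' k = a k + c' * real_expo m k"
          using fun_cong[OF b(3), of k] fun_cong[OF b'(3), of k] by auto
        then have "c' * b k + c * b' k = (c + c') * a k" by (simp only:) (simp add: algebra_simps)
        then have "a k = (c' * b k + c * b' k) / (c + c')" using pos by simp
        then show ?thesis by (simp add: add_divide_distrib)
      qed
      then have "a = (\<lambda>k. c' / (c + c') * b k) + (\<lambda>k. c / (c + c') * b' k)"
        by (simp add: fun_eq_iff)
      ultimately show ?thesis by simp
    qed
  qed
  \<comment> \<open>Inclusion-exclusion: \<open>?P\<close> and \<open>?N\<close> have union
    \<open>?L\<close> and intersection \<open>conic G\<close>.\<close>
  have "lattice_series (conic G) - (lattice_series ?P + lattice_series ?N) = (\<lambda>a. - lattice_series ?L a)"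
  proof
    fix a
    show "(lattice_series (conic G) - (lattice_series ?P + lattice_series ?N)) a = - lattice_series ?L a"
      using sub un[of "real_expo a"] int[of "real_expo a"]
      by (cases "real_expo a \<in> ?P"; cases "real_expo a \<in> ?N"; cases "real_expo a \<in> conic G"; cases "real_expo a \<in> ?L")
         (simp add: lattice_series_eq; blast)+
  qed
  moreover have "null_gf (\<lambda>a. - lattice_series ?L a)"
  proof (rule null_gf_periodic[OF assms])
    fix a
    have "real_expo m \<in> ?L" "- real_expo m \<in> ?L" by (auto intro: conic_gen)
    then have "real_expo (a - m) \<in> ?L \<longleftrightarrow> real_expo a \<in> ?L"
      using conic_add[of "real_expo m" _ "real_expo (a - m)"] conic_add[of "- real_expo m" _ "real_expo a"]
      by (auto simp: real_expo_diff)
    then show "- lattice_series ?L (a - m) = - lattice_series ?L a"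
      by (simp add: lattice_series_eq)
  qed
  ultimately show ?thesis by simp
qed

section \<open>Decomposing cones along total orders\<close>

definition arc :: "nat \<Rightarrow> nat \<Rightarrow> nat \<Rightarrow> real" where
  "arc x y = indicator {x} - indicator {y}"

definition set_expo :: "nat set \<Rightarrow> expo" where
  "set_expo J = (\<Sum>i\<in>J. Poly_Mapping.single i 1)"

lemma real_expo_set: "finite J \<Longrightarrow> real_expo (set_expo J) = indicator J"
  by (auto simp: real_expo_def set_expo_def lookup_sum lookup_single fun_eq_iff when_def indicator_def)

lemma arc_eq_real_expo: "arc x y = real_expo (set_expo {x} - set_expo {y})"
  by (simp add: arc_def real_expo_diff real_expo_set)

lemma arc_self [simp]: "arc x x = 0"
  by (simp add: arc_def)

lemma arc_uminus: "- arc x y = arc y x"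
  by (simp add: arc_def)

lemma arc_trans: "arc x y + arc y z = arc x z"
  by (simp add: arc_def)

lemma conic_insert_zero: "conic (insert 0 G) = conic G"
  by (rule conic_eqI) (auto intro: conic.zero conic_gen)

lemma null_gf_flip_arc:
  assumes "x \<noteq> y"
  shows "null_gf (lattice_series (conic G) - (lattice_series (conic (insert (arc x y) G))
    + lattice_series (conic (insert (arc y x) G))))"
proof -
  have "set_expo {x} - set_expo {y} \<noteq> 0"
  proof
    assume "set_expo {x} - set_expo {y} = 0"
    then have "Poly_Mapping.lookup (set_expo {x} - set_expo {y}) x = 0" by simp
    then show False using assms by (simp add: set_expo_def lookup_minus lookup_single)
  qed
  from null_gf_flip[OF this, of G] show ?thesis
    by (simp add: arc_eq_real_expo[symmetric] arc_uminus)
qed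

text \<open>The summand of \<open>x\<close> declares \<open>x\<close> the last element of
  \<open>V\<close>. When \<open>z\<close> joins \<open>V\<close>, the summand of each old
  \<open>x\<close> is split by comparing \<open>x\<close> with \<open>z\<close>. The pieces where
  \<open>x\<close> wins are the new summands; those where \<open>z\<close> wins recombine, by the
  induction hypothesis for \<open>G\<close> with the arcs out of \<open>z\<close>, to the summand of
  \<open>z\<close>.\<close>

lemma null_gf_select:
  assumes "finite V" and "V \<noteq> {}"
  shows "null_gf (lattice_series (conic G) - (\<Sum>x\<in>V. lattice_series (conic (G \<union> arc x ` V))))"
  using assms
proof (induction arbitrary: G rule: finite_ne_induct)
  case (singleton x)
  have "G \<union> arc x ` {x} = insert 0 G" by simp
  then have "lattice_series (conic G) = (\<Sum>y\<in>{x}. lattice_series (conic (G \<union> arc y ` {x})))"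
    by (simp add: conic_insert_zero)
  then show ?case
    by (rule null_gf_eqI)
next
  case (insert z V)
  let ?s = "\<lambda>G. lattice_series (conic G)"
  have flip: "null_gf (?s (G \<union> arc x ` V)
      - (?s (G \<union> arc x ` insert z V) + ?s ((G \<union> arc z ` V) \<union> arc x ` V)))" if "x \<in> V" for x
  proof -
    \<comment> \<open>As \<open>z\<close> comes after \<open>x\<close> and \<open>x\<close> after
      the rest of \<open>V\<close>, all arcs from \<open>z\<close> to \<open>V\<close> already lie
      in the cone.\<close>
    have "conic (insert (arc z x) (G \<union> arc x ` V)) = conic ((G \<union> arc z ` V) \<union> arc x ` V)"
    proof (rule conic_eqI)
      show "insert (arc z x) (G \<union> arc x ` V) \<subseteq> conic ((G \<union> arc z ` V) \<union> arc x ` V)"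
        using that by (auto intro: conic_gen)
      have "arc z y \<in> conic (insert (arc z x) (G \<union> arc x ` V))" if "y \<in> V" for y
        unfolding arc_trans[of z x y, symmetric] using that by (intro conic_add) (auto intro: conic_gen)
      then show "(G \<union> arc z ` V) \<union> arc x ` V \<subseteq> conic (insert (arc z x) (G \<union> arc x ` V))"
        by (auto intro: conic_gen)
    qed
    moreover have "x \<noteq> z" using that insert.hyps by auto
    ultimately show ?thesis
      using null_gf_flip_arc[of x z "G \<union> arc x ` V"] by simp
  qed
  have z: "conic (G \<union> arc z ` insert z V) = conic (G \<union> arc z ` V)"
    by (simp add: conic_insert_zero)
  \<comment> \<open>The induction hypothesis enters twice, for \<open>G\<close> and for
    \<open>G\<close> with the arcs from \<open>z\<close> to \<open>V\<close>.\<close>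
  have "null_gf (((?s G - (\<Sum>x\<in>V. ?s (G \<union> arc x ` V)))
      + (\<Sum>x\<in>V. ?s (G \<union> arc x ` V) - (?s (G \<union> arc x ` insert z V) + ?s ((G \<union> arc z ` V) \<union> arc x ` V))))
      - (?s (G \<union> arc z ` V) - (\<Sum>x\<in>V. ?s ((G \<union> arc z ` V) \<union> arc x ` V))))"
    using null_gf_sum[of V "\<lambda>x. ?s (G \<union> arc x ` V)"] flip
    by (intro null_gf_diff null_gf_add insert.IH) (simp add: sum_subtractf)
  also have "((?s G - (\<Sum>x\<in>V. ?s (G \<union> arc x ` V)))
      + (\<Sum>x\<in>V. ?s (G \<union> arc x ` V) - (?s (G \<union> arc x ` insert z V) + ?s ((G \<union> arc z ` V) \<union> arc x ` V))))
      - (?s (G \<union> arc z ` V) - (\<Sum>x\<in>V. ?s ((G \<union> arc z ` V) \<union> arc x ` V)))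
      = ?s G - (?s (G \<union> arc z ` insert z V) + (\<Sum>x\<in>V. ?s (G \<union> arc x ` insert z V)))"
    unfolding z sum_subtractf sum.distrib by (simp add: algebra_simps)
  finally show ?case
    using insert.hyps by simp
qed

section \<open>Cones of total orders\<close>

fun chain_arcs :: "nat list \<Rightarrow> (nat \<Rightarrow> real) set" where
  "chain_arcs (x # y # w) = insert (arc x y) (chain_arcs (y # w))"
| "chain_arcs _ = {}"

text \<open>The difference telescopes along the list from \<open>x\<close> to
  \<open>y\<close>.\<close>

lemma arc_in_chain_conic: "y \<in> set (x # w) \<Longrightarrow> arc x y \<in> conic (chain_arcs (x # w))"
proof (induction w arbitrary: x)
  case Nil
  then have "y = x" by simp
  then show ?case by (simp only: arc_self conic.zero)
next
  case (Cons z w)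
  show ?case
  proof (cases "y = x")
    case True
    then show ?thesis by (simp only: arc_self conic.zero)
  next
    case False
    then have "arc z y \<in> conic (chain_arcs (z # w))" using Cons by auto
    then have "arc z y \<in> conic (chain_arcs (x # z # w))"
      using conic_mono[of "chain_arcs (z # w)" "chain_arcs (x # z # w)"] by auto
    then show ?thesis
      unfolding arc_trans[of x z y, symmetric] by (intro conic_add) (auto intro: conic_gen)
  qed
qed

text \<open>Choose the last element \<open>x\<close> by \<open>null_gf_select\<close> and recurse on
  \<open>V - {x}\<close> with the arcs out of \<open>x\<close> as further generators. Once the rest
  is ordered, the arc from \<open>x\<close> to the next element generates them together with the
  other consecutive arcs.\<close>

lemma null_gf_chains:
  assumes "finite V"
  shows "null_gf (lattice_series (conic G)
    - (\<Sum>w\<in>permutations_of_set V. lattice_series (conic (G \<union> chain_arcs w))))"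
  using assms
proof (induction V arbitrary: G rule: finite_psubset_induct)
  case (psubset V)
  let ?s = "\<lambda>G. lattice_series (conic G)"
  show ?case
  proof (cases "V = {}")
    case True
    show ?thesis by (rule null_gf_eqI) (simp add: True)
  next
    case False
    have step: "null_gf (?s (G \<union> arc x ` V)
        - (\<Sum>w\<in>permutations_of_set (V - {x}). ?s (G \<union> chain_arcs (x # w))))" if x: "x \<in> V" for x
    proof -
      have "conic ((G \<union> arc x ` V) \<union> chain_arcs w) = conic (G \<union> chain_arcs (x # w))"
        if "w \<in> permutations_of_set (V - {x})" for w
      proof (rule conic_eqI)
        have w: "set w = V - {x}" using that by (rule permutations_of_setD)
        have "arc x ` V \<subseteq> conic (chain_arcs (x # w))"
          by (intro image_subsetI arc_in_chain_conic) (use w in auto)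
        also have "\<dots> \<subseteq> conic (G \<union> chain_arcs (x # w))" by (rule conic_mono) simp
        finally have "arc x ` V \<subseteq> conic (G \<union> chain_arcs (x # w))" .
        moreover have "chain_arcs w \<subseteq> chain_arcs (x # w)" by (cases w) auto
        ultimately show "(G \<union> arc x ` V) \<union> chain_arcs w \<subseteq> conic (G \<union> chain_arcs (x # w))"
          using conic_gen[of _ "G \<union> chain_arcs (x # w)"] by blast
        have "chain_arcs (x # w) \<subseteq> arc x ` V \<union> chain_arcs w"
          using w by (cases w) auto
        then show "G \<union> chain_arcs (x # w) \<subseteq> conic ((G \<union> arc x ` V) \<union> chain_arcs w)"
          using conic_gen[of _ "(G \<union> arc x ` V) \<union> chain_arcs w"] by blast
      qed
      then have eq: "(\<Sum>w\<in>permutations_of_set (V - {x}). ?s ((G \<union> arc x ` V) \<union> chain_arcs w))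
          = (\<Sum>w\<in>permutations_of_set (V - {x}). ?s (G \<union> chain_arcs (x # w)))"
        by (intro sum.cong) auto
      have "null_gf (?s (G \<union> arc x ` V)
          - (\<Sum>w\<in>permutations_of_set (V - {x}). ?s ((G \<union> arc x ` V) \<union> chain_arcs w)))"
        by (rule psubset.IH) (use x in auto)
      then show ?thesis by (simp only: eq)
    qed
    have "null_gf ((?s G - (\<Sum>x\<in>V. ?s (G \<union> arc x ` V))) + ((\<Sum>x\<in>V. ?s (G \<union> arc x ` V))
        - (\<Sum>x\<in>V. \<Sum>w\<in>permutations_of_set (V - {x}). ?s (G \<union> chain_arcs (x # w)))))"
      by (intro null_gf_add null_gf_select null_gf_sum step psubset.hyps False)
    then have "null_gf (?s G - (\<Sum>w\<in>permutations_of_set V. ?s (G \<union> chain_arcs w)))"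
      by (simp add: sum_permutations_of_set[OF psubset.hyps(1) False])
    then show ?thesis .
  qed
qed

lemma conic_empty: "conic {} = {0}"
proof
  show "conic {} \<subseteq> {0 :: 'a \<Rightarrow> real}"
  proof
    fix a :: "'a \<Rightarrow> real" assume "a \<in> conic {}"
    then show "a \<in> {0}" by (induction rule: conic.induct) auto
  qed
qed (auto intro: conic.zero)

lemma chain_conic_support: "a \<in> conic (chain_arcs w) \<Longrightarrow> k \<notin> set w \<Longrightarrow> a k = 0"
proof (induction rule: conic.induct)
  case (step a g c)
  have "g k = 0" if "g \<in> chain_arcs w" "k \<notin> set w"
    using that by (induction w rule: chain_arcs.induct) (auto simp: arc_def)
  then show ?case using step by simp
qed simp

section \<open>The Hilbert series of the cone of a total order\<close>

definition tfrac :: "nat \<Rightarrow> ratfun" where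
  "tfrac i = to_fract (tvar i)"

lemma tvar_eq_iff: "tvar i = tvar j \<longleftrightarrow> i = j"
  by (metis lookup_single_eq lookup_single_not_eq tvar_def zero_neq_one)

lemma tfrac_inj: "inj tfrac"
  by (auto simp: inj_def tfrac_def tvar_eq_iff)

lemma tfrac_nonzero: "tfrac i \<noteq> 0"
  using tvar_mult_inv[of i] by (auto simp: tfrac_def)

text \<open>Multiplication by \<open>1 - t^m\<close>, where \<open>t^m\<close> is the quotient of
  the variables of \<open>x\<close> and \<open>y\<close>, subtracts from the cone its translate by
  \<open>arc x y\<close>. What remains is the cone of the tail, because \<open>arc x y\<close> is
  the only generator with a nonzero coordinate at \<open>x\<close>.\<close>

lemma has_gf_chain:
  assumes "distinct w"
  shows "has_gf (lattice_series (conic (chain_arcs w))) (chain_hilb tfrac w)"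
proof -
  have base: "has_gf (lattice_series (conic {})) 1"
  proof -
    have "real_expo a = 0 \<longleftrightarrow> a = 0" for a
      by (auto simp: real_expo_def fun_eq_iff poly_mapping_eq_iff)
    then have "lattice_series (conic {}) = Poly_Mapping.lookup (1 :: laurent)"
      by (auto simp: fun_eq_iff lattice_series_eq conic_empty lookup_one)
    then show ?thesis using has_gf_lookup[of 1] by simp
  qed
  show ?thesis
    using assms
  proof (induction w rule: chain_arcs.induct)
    case (1 x y w)
    let ?C = "conic (chain_arcs (y # w))" and ?C' = "conic (chain_arcs (x # y # w))"
    define m where "m = set_expo {x} - set_expo {y}"
    let ?q = "1 - Poly_Mapping.single m 1 :: laurent"
    have ne: "x \<noteq> y" "x \<notin> set (y # w)" using 1 by auto
    have m: "real_expo m = arc x y" by (simp add: m_def arc_eq_real_expo)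
    have arc: "arc x y x = 1" using ne by (simp add: arc_def)
    have supp: "b x = 0" if "b \<in> ?C" for b using chain_conic_support[OF that] ne by auto
    have "laurent_act ?q (lattice_series ?C') = lattice_series ?C"
    proof
      fix a
      let ?b = "real_expo a"
      have 1: "?b \<in> ?C \<longleftrightarrow> ?b \<in> ?C' \<and> ?b x = 0"
      proof
        assume "?b \<in> ?C"
        then show "?b \<in> ?C' \<and> ?b x = 0"
          using supp conic_mono[of "chain_arcs (y # w)" "chain_arcs (x # y # w)"] by auto
      next
        assume *: "?b \<in> ?C' \<and> ?b x = 0"
        then have "?b \<in> conic (insert (arc x y) (chain_arcs (y # w)))" by simp
        then obtain b' c where b': "b' \<in> ?C" "0 \<le> c" "?b = b' + (\<lambda>k. c * arc x y k)"
          by (rule conic_insertE)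
        then have "c = 0" using * supp[of b'] arc by (simp add: fun_eq_iff[of ?b])
        then show "?b \<in> ?C" using b' by (simp add: plus_fun_def)
      qed
      have 2: "?b - arc x y \<in> ?C' \<longleftrightarrow> ?b \<in> ?C' \<and> 1 \<le> ?b x"
      proof
        assume *: "?b - arc x y \<in> ?C'"
        then have "?b - arc x y \<in> conic (insert (arc x y) (chain_arcs (y # w)))" by simp
        then obtain b' c where b': "b' \<in> ?C" "0 \<le> c" "?b - arc x y = b' + (\<lambda>k. c * arc x y k)"
          by (rule conic_insertE)
        have "?b x - 1 = c" using fun_cong[OF b'(3), of x] supp[OF b'(1)] arc by simp
        moreover have "(?b - arc x y) + arc x y \<in> ?C'"
          using * by (intro conic_add) (auto intro: conic_gen)
        ultimately show "?b \<in> ?C' \<and> 1 \<le> ?b x" using b'(2) by auto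
      next
        assume *: "?b \<in> ?C' \<and> 1 \<le> ?b x"
        then have "?b \<in> conic (insert (arc x y) (chain_arcs (y # w)))" by simp
        then obtain b' c where b': "b' \<in> ?C" "0 \<le> c" "?b = b' + (\<lambda>k. c * arc x y k)"
          by (rule conic_insertE)
        have "?b x = c" using fun_cong[OF b'(3), of x] supp[OF b'(1)] arc by simp
        then have "b' + (\<lambda>k. (c - 1) * arc x y k) \<in> ?C'"
          using b' * by (auto intro: conic_insertI)
        moreover have "?b - arc x y = b' + (\<lambda>k. (c - 1) * arc x y k)"
          using b'(3) by (auto simp: fun_eq_iff algebra_simps)
        ultimately show "?b - arc x y \<in> ?C'" by simp
      qed
      \<comment> \<open>Unimodularity: at a lattice point the coefficient of \<open>arc x y\<close>
        equals the coordinate at \<open>x\<close> and is therefore an integer.\<close>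
      have 3: "?b x = 0 \<or> 1 \<le> ?b x" if "?b \<in> ?C'"
      proof -
        have "?b \<in> conic (insert (arc x y) (chain_arcs (y # w)))" using that by simp
        then obtain b' c where b': "b' \<in> ?C" "0 \<le> c" "?b = b' + (\<lambda>k. c * arc x y k)"
          by (rule conic_insertE)
        have "?b x = c" using fun_cong[OF b'(3), of x] supp[OF b'(1)] arc by simp
        then show ?thesis using b'(2) by (auto simp: real_expo_def)
      qed
      have "laurent_act ?q (lattice_series ?C') a = lattice_series ?C' a - lattice_series ?C' (a - m)"
      proof -
        have "laurent_act ?q (lattice_series ?C') + laurent_act (Poly_Mapping.single m 1) (lattice_series ?C')
            = laurent_act (Poly_Mapping.single 0 1) (lattice_series ?C')"
          by (simp only: laurent_act_add_left[symmetric]) simp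
        from fun_cong[OF this, of a] show ?thesis by (simp add: laurent_act_single del: single_one)
      qed
      also have "\<dots> = lattice_series ?C a"
        using 1 2 3 by (auto simp: lattice_series_eq real_expo_diff m of_bool_def)
      finally show "laurent_act ?q (lattice_series ?C') a = lattice_series ?C a" .
    qed
    moreover have "Poly_Mapping.single m 1 * tvar y = tvar x"
      by (simp add: m_def tvar_def set_expo_def mult_single)
    then have "to_fract (Poly_Mapping.single m 1) * tfrac y = tfrac x"
      unfolding tfrac_def by (simp flip: to_fract_mult)
    then have q: "to_fract ?q = 1 - tfrac x / tfrac y"
      using tfrac_nonzero[of y] by (simp add: field_simps)
    moreover have "?q \<noteq> 0"
      using q tfrac_inj tfrac_nonzero[of y] ne by (auto simp: inj_eq)
    ultimately show ?case
      using has_gf_act[of ?q "lattice_series ?C'" "chain_hilb tfrac (y # w)"] 1 by simp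
  qed (use base in auto)
qed

text \<open>Summation by parts: the coefficient of an arc is the sum of \<open>a\<close> over the
  entries up to that arc, which is minus the sum over the remaining tail. The recursion takes off
  the first arc, moving the value \<open>a x\<close> onto the next entry \<open>y\<close>.\<close>

lemma chain_conicI:
  assumes "distinct w" and "\<And>k. k \<notin> set w \<Longrightarrow> a k = 0" and "(\<Sum>k\<in>set w. a k) = 0"
    and "\<And>n. (\<Sum>k\<in>set (drop n w). a k) \<le> 0"
  shows "a \<in> conic (chain_arcs w)"
  using assms
proof (induction w arbitrary: a rule: chain_arcs.induct)
  case (1 x y w)
  define c where "c = a x"
  define a' where "a' = a - (\<lambda>k. c * arc x y k)"
  have ne: "x \<noteq> y" "x \<notin> set (y # w)" using 1 by auto
  have sum: "a x + (\<Sum>k\<in>set (y # w). a k) = 0" using 1(4) ne by simp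
  have c: "0 \<le> c" using 1(5)[of 1] sum by (simp add: c_def)
  have a': "(\<Sum>k\<in>T. a' k) = (\<Sum>k\<in>T. a k) + (if y \<in> T then c else 0)" if "T \<subseteq> set (y # w)" for T
  proof -
    have "finite T" "x \<notin> T" using that ne finite_subset by auto
    then show ?thesis
      by (auto simp: a'_def arc_def sum_subtractf sum.distrib right_diff_distrib indicator_def
          sum.If_cases if_distrib[of "\<lambda>z. c * z"] sum.delta cong: if_cong)
  qed
  have "a' \<in> conic (chain_arcs (y # w))"
  proof (rule 1(1))
    show "distinct (y # w)" using 1 by simp
    show "a' k = 0" if "k \<notin> set (y # w)" for k
      using that 1(3)[of k] ne by (cases "k = x") (auto simp: a'_def arc_def c_def)
    show total: "(\<Sum>k\<in>set (y # w). a' k) = 0" using a'[of "set (y # w)"] sum c_def by simp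
    show "(\<Sum>k\<in>set (drop n (y # w)). a' k) \<le> 0" for n
    proof (cases n)
      case 0
      then show ?thesis using total by simp
    next
      case (Suc j)
      \<comment> \<open>A proper tail of \<open>y # w\<close> misses \<open>y\<close>, where alone
        \<open>a'\<close> differs from \<open>a\<close> on this list. The bound for \<open>a\<close>
        thus carries over, with the index raised by one for the entry \<open>x\<close>.\<close>
      have "set (drop j w) \<subseteq> set w" by (rule set_drop_subset)
      moreover have "y \<notin> set w" using 1 by simp
      ultimately have "set (drop j w) \<subseteq> set (y # w)" "y \<notin> set (drop j w)" by auto
      then show ?thesis
        using a'[of "set (drop j w)"] 1(5)[of "Suc (Suc j)"] Suc by simp
    qed
  qed
  then have "a' + (\<lambda>k. c * arc x y k) \<in> conic (chain_arcs (x # y # w))"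
    using c by (auto intro: conic_insertI)
  then show ?case by (simp add: a'_def)
next
  case "2_1"
  then have "a = 0" by (auto simp: fun_eq_iff)
  then show ?case by (simp only: conic.zero)
next
  case ("2_2" x)
  then have "a k = 0" for k by (cases "k = x") auto
  then have "a = 0" by (auto simp: fun_eq_iff)
  then show ?case by (simp only: conic.zero)
qed

text \<open>Passes from explicit combinations to the inductive description, where generators are
  added and exchanged without tracking coefficients.\<close>

lemma Cone_eq_conic:
  assumes "finite M" and "I \<in> M"
  shows "Cone M I = conic ((\<lambda>J. indicator J - indicator I) ` M)" (is "_ = conic ?G")
proof -
  have "Cone M I = {(\<lambda>k. \<Sum>J\<in>M. c J * (indicator J k - indicator I k)) | c. \<forall>J\<in>M. 0 \<le> c J}"
    using assms by (simp add: Cone_def)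
  also have "\<dots> = conic ?G"
  proof (intro equalityI subsetI)
    fix a :: "nat \<Rightarrow> real"
    assume "a \<in> {(\<lambda>k. \<Sum>J\<in>M. c J * (indicator J k - indicator I k)) | c. \<forall>J\<in>M. 0 \<le> c J}"
    then obtain c where c: "\<forall>J\<in>M. 0 \<le> c J"
      and a: "a = (\<lambda>k. \<Sum>J\<in>M. c J * (indicator J k - indicator I k))" by blast
    have "(\<lambda>k. \<Sum>J\<in>N. c J * (indicator J k - indicator I k)) \<in> conic ?G" if "finite N" "N \<subseteq> M" for N
      using that
    proof (induction N)
      case empty
      have "(\<lambda>k. \<Sum>J\<in>{}. c J * (indicator J k - indicator I k)) = (0 :: nat \<Rightarrow> real)"
        by (simp add: fun_eq_iff)
      then show ?case using conic.zero[of ?G] by metis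
    next
      case (insert J N)
      then have "(\<lambda>k. \<Sum>J\<in>N. c J * (indicator J k - indicator I k))
          + (\<lambda>k. c J * (indicator J - indicator I) k) \<in> conic ?G"
        using c by (intro conic.step imageI) blast+
      moreover have "(\<lambda>k. \<Sum>J\<in>N. c J * (indicator J k - indicator I k))
          + (\<lambda>k. c J * (indicator J - indicator I) k)
          = (\<lambda>k. \<Sum>J\<in>insert J N. c J * (indicator J k - indicator I k))"
        using insert.hyps by (simp add: fun_eq_iff)
      ultimately show ?case by metis
    qed
    then show "a \<in> conic ?G" using a assms by simp
  next
    fix a assume "a \<in> conic ?G"
    then show "a \<in> {(\<lambda>k. \<Sum>J\<in>M. c J * (indicator J k - indicator I k)) | c. \<forall>J\<in>M. 0 \<le> c J}"
    proof (induction rule: conic.induct)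
      case zero
      show ?case by (rule CollectI, rule exI[of _ "\<lambda>_. 0"]) (simp add: fun_eq_iff)
    next
      case (step a g s)
      then obtain c J where c: "\<forall>J\<in>M. 0 \<le> c J" "J \<in> M" "g = indicator J - indicator I"
        and a: "a = (\<lambda>k. \<Sum>J\<in>M. c J * (indicator J k - indicator I k))" by blast
      have "a + (\<lambda>k. s * g k)
          = (\<lambda>k. \<Sum>J'\<in>M. (c J' + (if J' = J then s else 0)) * (indicator J' k - indicator I k))"
        using c(2) assms(1)
        by (simp add: a c(3) fun_eq_iff distrib_right sum.distrib if_distrib[of "\<lambda>z. z * _"] sum.delta cong: if_cong)
      then show ?case
        using c step.hyps by (intro CollectI exI[of _ "\<lambda>J'. c J' + (if J' = J then s else 0)"]) auto
    qed
  qed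
  finally show ?thesis .
qed

section \<open>Matroids\<close>

text \<open>Since lists run from last to first, \<open>w\<close> holds the elements that precede
  \<open>x\<close>, and \<open>x\<close> is taken exactly when it makes the rank jump.\<close>

fun greedy :: "('a set \<Rightarrow> nat) \<Rightarrow> 'a list \<Rightarrow> 'a set" where
  "greedy \<rho> [] = {}"
| "greedy \<rho> (x # w) = (if \<rho> (insert x (set w)) = \<rho> (set w) then greedy \<rho> w else insert x (greedy \<rho> w))"

lemma greedy_subset: "greedy \<rho> w \<subseteq> set w"
  by (induction w) auto

lemma finite_greedy [simp]: "finite (greedy \<rho> w)"
  by (rule finite_subset[OF greedy_subset]) simp

text \<open>Tails of the list are initial segments of the order, and the choices made there do not
  depend on later elements.\<close>

lemma greedy_Int_drop: "distinct w \<Longrightarrow> greedy \<rho> w \<inter> set (drop k w) = greedy \<rho> (drop k w)"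
proof (induction w arbitrary: k)
  case (Cons x w)
  show ?case
  proof (cases k)
    case 0
    then show ?thesis using greedy_subset[of \<rho> "x # w"] by auto
  next
    case (Suc j)
    have "x \<notin> set (drop j w)" using Cons.prems set_drop_subset[of j w] by auto
    then show ?thesis using Cons Suc by auto
  qed
qed simp

lemma chain_weight_greedy:
  assumes "distinct w"
  shows "chain_weight \<rho> t u v w
    = (\<Prod>i\<in>greedy \<rho> w. t i + u) * (\<Prod>j\<in>set w - greedy \<rho> w. 1 + v * t j)"
  using assms
proof (induction w)
  case (Cons x w)
  have x: "x \<notin> greedy \<rho> w" "x \<notin> set w - greedy \<rho> w" using Cons.prems greedy_subset[of \<rho> w] by auto
  have "insert x (set w) - greedy \<rho> w = insert x (set w - greedy \<rho> w)"
    "insert x (set w) - insert x (greedy \<rho> w) = set w - greedy \<rho> w"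
    using x Cons.prems by auto
  then show ?case using Cons x by (simp add: mult_ac)
qed simp

lemma (in unit_rank) card_greedy: "distinct w \<Longrightarrow> card (greedy \<rho> w) = \<rho> (set w)"
proof (induction w)
  case Nil
  show ?case by (simp add: rank_empty)
next
  case (Cons x w)
  have "x \<notin> greedy \<rho> w" using Cons.prems greedy_subset[of \<rho> w] by auto
  then show ?case using Cons rank_insert[of "set w" x] by auto
qed

section \<open>Bases and rank function of a matroid\<close>

locale matroid_bases =
  fixes n d :: nat and M :: "nat set set"
  assumes matroid: "is_matroid n d M"
begin

lemma basisD:
  assumes "I \<in> M"
  shows "I \<subseteq> {1..n}" and "card I = d" and "finite I"
proof -
  show "I \<subseteq> {1..n}" "card I = d" using matroid assms by (simp_all add: is_matroid_def)
  then show "finite I" using finite_subset by blast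
qed

lemma finite_bases: "finite M"
  using basisD(1) by (intro finite_subset[of M "Pow {1..n}"]) auto

lemma bases_nonempty: "M \<noteq> {}"
  using matroid by (simp add: is_matroid_def)

lemma exchange:
  assumes "A \<in> M" and "B \<in> M" and "a \<in> A - B"
  obtains b where "b \<in> B - A" and "insert b (A - {a}) \<in> M"
proof -
  have "\<exists>b\<in>B - A. insert b (A - {a}) \<in> M"
    using matroid assms unfolding is_matroid_def by blast
  then show thesis using that by blast
qed

lemma rank_ge: "I \<in> M \<Longrightarrow> card (S \<inter> I) \<le> rank_fn M S"
  unfolding rank_fn_def using finite_bases by (intro Max_ge) auto

lemma rank_attained: obtains I where "I \<in> M" and "card (S \<inter> I) = rank_fn M S"
proof -
  have "rank_fn M S \<in> (\<lambda>I. card (S \<inter> I)) ` M"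
    unfolding rank_fn_def using finite_bases bases_nonempty by (intro Max_in) auto
  then show thesis using that by auto
qed

text \<open>Bases optimal for \<open>S\<close> and for \<open>insert x S\<close> give the two
  bounds, as one more point changes an intersection by at most one.\<close>

sublocale unit_rank "rank_fn M"
proof
  obtain I where "I \<in> M" "card ({} \<inter> I) = rank_fn M {}" by (rule rank_attained)
  then show "rank_fn M {} = 0" by simp
next
  fix S :: "nat set" and x
  obtain I where I: "I \<in> M" "card (S \<inter> I) = rank_fn M S" by (rule rank_attained)
  obtain J where J: "J \<in> M" "card (insert x S \<inter> J) = rank_fn M (insert x S)" by (rule rank_attained)
  have "card (S \<inter> I) \<le> card (insert x S \<inter> I)"
    using basisD(3)[OF I(1)] by (intro card_mono) auto
  then have "rank_fn M S \<le> rank_fn M (insert x S)"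
    using I rank_ge[OF I(1), of "insert x S"] by linarith
  moreover have "card (insert x S \<inter> J) \<le> card (insert x (S \<inter> J))"
    using basisD(3)[OF J(1)] by (intro card_mono) auto
  then have "rank_fn M (insert x S) \<le> Suc (rank_fn M S)"
    using J rank_ge[OF J(1), of S] card_insert_le_m1[of "Suc (card (S \<inter> J))" "S \<inter> J" x]
      basisD(3)[OF J(1)] by (simp add: card_insert_if split: if_splits)
  ultimately show "rank_fn M (insert x S) = rank_fn M S \<or> rank_fn M (insert x S) = Suc (rank_fn M S)"
    by linarith
qed

lemma rank_full: "rank_fn M {1..n} = d"
proof -
  obtain I where "I \<in> M" "card ({1..n} \<inter> I) = rank_fn M {1..n}" by (rule rank_attained)
  then show ?thesis using basisD[of I] by (simp add: Int_absorb1)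
qed

text \<open>Let \<open>A\<close> be optimal for \<open>insert x S\<close>, and among the bases with
  the same trace on \<open>S\<close> as \<open>B\<close> choose \<open>B'\<close> with the largest
  overlap with \<open>A\<close>. If \<open>x\<close> were not in \<open>B'\<close>, then
  \<open>B'\<close> would have more elements outside \<open>insert x S\<close> than
  \<open>A\<close>. Exchanging one that is not in \<open>A\<close> for an element of
  \<open>A\<close> would exceed the rank of \<open>S\<close> or enlarge the overlap.\<close>

lemma basis_augment:
  assumes "B \<in> M" and "card (S \<inter> B) = rank_fn M S" and "rank_fn M (insert x S) \<noteq> rank_fn M S"
    and "finite S"
  obtains B' where "B' \<in> M" and "S \<inter> B' = S \<inter> B" and "x \<in> B'"
proof -
  obtain A where A: "A \<in> M" "card (insert x S \<inter> A) = rank_fn M (insert x S)" by (rule rank_attained)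
  have rank: "rank_fn M (insert x S) = Suc (rank_fn M S)"
    using rank_insert[OF assms(4), of x] assms(3) by auto
  define F where "F = {B' \<in> M. S \<inter> B' = S \<inter> B}"
  have "finite F" "F \<noteq> {}" using finite_bases assms(1) by (auto simp: F_def)
  then have "Max ((\<lambda>C. card (C \<inter> A)) ` F) \<in> (\<lambda>C. card (C \<inter> A)) ` F" by (intro Max_in) auto
  then obtain B' where "B' \<in> F" and eq: "card (B' \<inter> A) = Max ((\<lambda>C. card (C \<inter> A)) ` F)" by auto
  then have B': "B' \<in> M" "S \<inter> B' = S \<inter> B" by (auto simp: F_def)
  have max: "card (C \<inter> A) \<le> card (B' \<inter> A)" if "C \<in> M" "S \<inter> C = S \<inter> B" for C
    unfolding eq using that \<open>finite F\<close> by (intro Max_ge) (auto simp: F_def)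
  have fin: "finite A" "finite B'" using A B' basisD(3) by auto
  have "x \<in> B'"
  proof (rule ccontr)
    assume x: "x \<notin> B'"
    have "card (insert x S \<inter> B') = rank_fn M S" using x B'(2) assms(2) by simp
    then have "card (insert x S \<inter> B') < card (insert x S \<inter> A)" using A(2) rank by simp
    moreover have split: "card C = card (insert x S \<inter> C) + card (C - insert x S)" if "finite C" for C
      using card_Int_Diff[OF that, of "insert x S"] by (simp add: Int_commute)
    ultimately have "card (A - insert x S) < card (B' - insert x S)"
      using split[OF fin(1)] split[OF fin(2)] basisD(2)[OF A(1)] basisD(2)[OF B'(1)] by linarith
    then have "\<not> B' - insert x S \<subseteq> A - insert x S"
      using fin card_mono[of "A - insert x S" "B' - insert x S"] by auto
    then obtain a where a: "a \<in> B' - A" "a \<notin> insert x S" by auto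
    obtain b where b: "b \<in> A - B'" "insert b (B' - {a}) \<in> M" using exchange[OF B'(1) A(1) a(1)] .
    show False
    proof (cases "b \<in> S")
      case True
      then have "S \<inter> insert b (B' - {a}) = insert b (S \<inter> B')" using a by auto
      then have "card (S \<inter> insert b (B' - {a})) = Suc (rank_fn M S)"
        using b fin assms(2) by (simp add: B'(2)[symmetric])
      then show False using rank_ge[OF b(2), of S] by simp
    next
      \<comment> \<open>This covers \<open>b = x\<close> as well.\<close>
      case False
      then have "S \<inter> insert b (B' - {a}) = S \<inter> B" using a B'(2) by auto
      then have "card (insert b (B' - {a}) \<inter> A) \<le> card (B' \<inter> A)" using max b(2) by blast
      moreover have "insert b (B' - {a}) \<inter> A = insert b (B' \<inter> A)" using a b by auto
      ultimately show False using b fin by simp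
    qed
  qed
  then show thesis using that B' by blast
qed

text \<open>The induction maintains a basis whose trace on the elements processed so far is the
  greedy set. It is kept when the rank stays and replaced through \<open>basis_augment\<close> when
  the rank jumps.\<close>

lemma greedy_extends: "distinct w \<Longrightarrow> \<exists>B\<in>M. set w \<inter> B = greedy (rank_fn M) w"
proof (induction w)
  case Nil
  then show ?case using bases_nonempty by auto
next
  case (Cons x w)
  then obtain B where B: "B \<in> M" "set w \<inter> B = greedy (rank_fn M) w" by auto
  then have card: "card (set w \<inter> B) = rank_fn M (set w)" using card_greedy[of w] Cons.prems by simp
  show ?case
  proof (cases "rank_fn M (insert x (set w)) = rank_fn M (set w)")
    case True
    have "x \<notin> B"
    proof
      assume "x \<in> B"
      then have "insert x (set w) \<inter> B = insert x (set w \<inter> B)" by auto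
      then have "card (insert x (set w) \<inter> B) = Suc (rank_fn M (set w))"
        using card Cons.prems by simp
      then show False using rank_ge[OF B(1), of "insert x (set w)"] True by simp
    qed
    then show ?thesis using B True by (intro bexI[of _ B]) auto
  next
    case False
    obtain B' where "B' \<in> M" "set w \<inter> B' = set w \<inter> B" "x \<in> B'"
      using basis_augment[OF B(1) card False] by auto
    then show ?thesis using B False by (intro bexI[of _ B']) auto
  qed
qed

lemma greedy_basis:
  assumes "w \<in> permutations_of_set {1..n}"
  shows "greedy (rank_fn M) w \<in> M"
proof -
  have w: "set w = {1..n}" "distinct w" using assms by (rule permutations_of_setD)+
  obtain B where "B \<in> M" "set w \<inter> B = greedy (rank_fn M) w" using greedy_extends[OF w(2)] by blast
  then show ?thesis using basisD(1)[of B] w(1) by (simp add: Int_absorb1)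
qed

text \<open>The greedy basis attains the rank of every tail of the list, so no basis meets a tail in
  more elements. This is the criterion of \<open>chain_conicI\<close>.\<close>

lemma greedy_optimal:
  assumes w: "w \<in> permutations_of_set {1..n}" and B: "B \<in> M"
  shows "indicator B - indicator (greedy (rank_fn M) w) \<in> conic (chain_arcs w)"
proof (rule chain_conicI)
  let ?J = "greedy (rank_fn M) w"
  have set_w: "set w = {1..n}" and dist: "distinct w" using w by (rule permutations_of_setD)+
  note J = greedy_basis[OF w]
  have sum: "(\<Sum>k\<in>T. (indicator B - indicator ?J) k) = real (card (T \<inter> B)) - real (card (T \<inter> ?J))"
    if "finite T" for T
    using that by (simp add: sum_subtractf indicator_def Int_def flip: sum.inter_filter)
  show "distinct w" by fact
  show "(indicator B - indicator ?J) k = (0::real)" if "k \<notin> set w" for k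
    using that set_w basisD(1)[OF B] basisD(1)[OF J] by (auto simp: indicator_def)
  show "(\<Sum>k\<in>set w. (indicator B - indicator ?J) k) = (0::real)"
    using sum[of "set w"] set_w basisD[OF B] basisD[OF J] by (simp add: Int_absorb1)
  show "(\<Sum>k\<in>set (drop m w). (indicator B - indicator ?J) k) \<le> (0::real)" for m
  proof -
    have "card (set (drop m w) \<inter> ?J) = rank_fn M (set (drop m w))"
      using greedy_Int_drop[OF dist, of "rank_fn M" m] card_greedy[of "drop m w"] dist
      by (simp add: Int_commute)
    then show ?thesis
      using sum[of "set (drop m w)"] rank_ge[OF B, of "set (drop m w)"] by simp
  qed
qed

lemma has_hilb_Cone:
  assumes "I \<in> M"
  shows "has_hilb (Cone M I)
    (\<Sum>w\<in>permutations_of_set {1..n}. if greedy (rank_fn M) w = I then chain_hilb tfrac w else 0)"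
proof -
  let ?G = "(\<lambda>J. indicator J - indicator I :: nat \<Rightarrow> real) ` M"
  have "has_gf (lattice_series (conic (?G \<union> chain_arcs w)))
      (if greedy (rank_fn M) w = I then chain_hilb tfrac w else 0)"
    if w: "w \<in> permutations_of_set {1..n}" for w
  proof (cases "greedy (rank_fn M) w = I")
    case True
    have "conic (?G \<union> chain_arcs w) = conic (chain_arcs w)"
    proof (rule conic_eqI)
      show "?G \<union> chain_arcs w \<subseteq> conic (chain_arcs w)"
        using greedy_optimal[OF w] conic_gen[of _ "chain_arcs w"] True by blast
      show "chain_arcs w \<subseteq> conic (?G \<union> chain_arcs w)"
        using conic_gen[of _ "?G \<union> chain_arcs w"] by blast
    qed
    then show ?thesis using has_gf_chain permutations_of_setD(2)[OF w] True by simp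
  next
    case False
    let ?J = "greedy (rank_fn M) w"
    note J = greedy_basis[OF w]
    \<comment> \<open>The line is spanned by \<open>m\<close>: its vector is a generator of the cone
      at \<open>I\<close>, and the negative lies in the cone of the order by optimality of
      \<open>?J\<close>.\<close>
    define m where "m = set_expo ?J - set_expo I"
    have m: "real_expo m = indicator ?J - indicator I"
      using basisD(3)[OF assms] by (simp add: m_def real_expo_diff real_expo_set)
    have "real_expo m \<in> conic (?G \<union> chain_arcs w)"
      using J by (auto simp: m intro!: conic_gen)
    moreover have "- real_expo m \<in> conic (chain_arcs w)"
      using greedy_optimal[OF w assms] by (simp add: m)
    then have "- real_expo m \<in> conic (?G \<union> chain_arcs w)"
      using conic_mono[of "chain_arcs w" "?G \<union> chain_arcs w"] by blast
    moreover have "m \<noteq> 0"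
    proof
      assume "m = 0"
      then have "(indicator ?J - indicator I :: nat \<Rightarrow> real) = 0"
        using m by (simp add: real_expo_def zero_fun_def)
      then have "indicator ?J k = (indicator I k :: real)" for k
        by (simp add: fun_eq_iff)
      then have "k \<in> ?J \<longleftrightarrow> k \<in> I" for k
        by (metis indicator_eq_1_iff)
      then show False using False by blast
    qed
    ultimately have "null_gf (lattice_series (conic (?G \<union> chain_arcs w)))"
      by (rule null_gf_line)
    then show ?thesis using False by (simp add: null_gf_iff)
  qed
  then have "has_gf (\<Sum>w\<in>permutations_of_set {1..n}. lattice_series (conic (?G \<union> chain_arcs w)))
      (\<Sum>w\<in>permutations_of_set {1..n}. if greedy (rank_fn M) w = I then chain_hilb tfrac w else 0)"
    by (rule has_gf_sum)
  moreover have "null_gf (lattice_series (conic ?G)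
      - (\<Sum>w\<in>permutations_of_set {1..n}. lattice_series (conic (?G \<union> chain_arcs w))))"
    by (rule null_gf_chains) simp
  ultimately show ?thesis
    unfolding has_hilb_eq Cone_eq_conic[OF finite_bases assms] by (rule has_gf_null[rotated])
qed

theorem sum_hilb_Cone:
  "(\<Sum>I\<in>M. hilb (Cone M I) * ((\<Prod>i\<in>I. tfrac i + u) * (\<Prod>j\<in>{1..n} - I. 1 + v * tfrac j)))
   = (\<Sum>S\<in>Pow {1..n}. (\<Prod>i\<in>S. tfrac i) * u ^ (d - rank_fn M S) * v ^ (card S - rank_fn M S))"
proof -
  let ?g = "greedy (rank_fn M)"
  let ?F = "\<lambda>I. (\<Prod>i\<in>I. tfrac i + u) * (\<Prod>j\<in>{1..n} - I. 1 + v * tfrac j)"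
  have "(\<Sum>I\<in>M. hilb (Cone M I) * ?F I)
      = (\<Sum>I\<in>M. \<Sum>w\<in>permutations_of_set {1..n}. if ?g w = I then chain_hilb tfrac w * ?F I else 0)"
    using hilb_eqI[OF has_hilb_Cone] by (intro sum.cong) (auto simp: sum_distrib_right intro!: sum.cong)
  \<comment> \<open>Every order contributes to exactly one basis, its greedy one.\<close>
  also have "\<dots> = (\<Sum>w\<in>permutations_of_set {1..n}. chain_hilb tfrac w * ?F (?g w))"
    using finite_bases greedy_basis by (subst sum.swap) (simp add: sum.delta)
  also have "\<dots> = (\<Sum>w\<in>permutations_of_set {1..n}. chain_hilb tfrac w * chain_weight (rank_fn M) tfrac u v w)"
  proof (intro sum.cong refl)
    fix w assume w: "w \<in> permutations_of_set {1..n}"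
    have "set w = {1..n}" "distinct w" using w by (rule permutations_of_setD)+
    then show "chain_hilb tfrac w * ?F (?g w)
        = chain_hilb tfrac w * chain_weight (rank_fn M) tfrac u v w"
      by (simp only: chain_weight_greedy)
  qed
  also have "\<dots> = (\<Sum>S\<in>Pow {1..n}. (\<Prod>i\<in>S. tfrac i) * u ^ (d - rank_fn M S) * v ^ (card S - rank_fn M S))"
    unfolding rank_full[symmetric]
    by (rule sum_chain_weight) (auto intro: inj_on_subset[OF tfrac_inj] simp: tfrac_nonzero)
  finally show ?thesis .
qed

end

section \<open>The pushforward\<close>

text \<open>A nonzero polynomial over an integral domain has finitely many roots. This is applied
  first to the inner variable, then to the outer one at the infinitely many constants
  \<open>[:v:]\<close>.\<close>

lemma poly_poly_eqI:
  fixes P Q :: "'a::idom poly poly"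
  assumes "infinite (UNIV :: 'a set)" and "\<And>u v. poly (poly P [:v:]) u = poly (poly Q [:v:]) u"
  shows "P = Q"
proof -
  have zero: "R = 0" if "infinite A" "\<And>x. x \<in> A \<Longrightarrow> poly R x = 0" for A and R :: "'b::idom poly"
    using that poly_roots_finite[of R] finite_subset[of A "{x. poly R x = 0}"] by auto
  have "poly (P - Q) [:v:] = 0" for v
    by (rule zero[OF assms(1)]) (simp add: assms(2))
  moreover have "infinite (range (\<lambda>v :: 'a. [:v:]))"
    using assms(1) finite_imageD[of "\<lambda>v :: 'a. [:v:]" UNIV] by (auto simp: inj_def)
  ultimately have "P - Q = 0"
    by (intro zero) auto
  then show ?thesis by simp
qed

lemma poly_uv_monom: "poly (poly (uv_monom c p q) [:v:]) u = c * u ^ p * v ^ q"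
  for c :: "'a::comm_ring_1"
proof -
  have "[:v:] ^ q = [:v ^ q:]" by (induction q) auto
  then show ?thesis by (simp add: uv_monom_def poly_monom mult_ac)
qed

text \<open>Additivity of \<open>f\<close> matters because several indices may share the same
  exponents.\<close>

lemma map_coeffs_sum_uv_monom:
  fixes f :: "'a::comm_monoid_add \<Rightarrow> 'b::comm_monoid_add"
  assumes "f 0 = 0" and "\<And>a b. f (a + b) = f a + f b"
  shows "map_coeffs f (\<Sum>i\<in>A. uv_monom (c i) (p i) (q i)) = (\<Sum>i\<in>A. uv_monom (f (c i)) (p i) (q i))"
proof -
  have zero: "map_poly f 0 = 0" by simp
  have coeff: "coeff (coeff (map_coeffs f P) k) l = f (coeff (coeff P k) l)" for P k l
    by (simp add: map_coeffs_def coeff_map_poly assms(1))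
  have add: "map_coeffs f (P + Q) = map_coeffs f P + map_coeffs f Q" for P Q
    by (intro poly_eqI) (simp add: coeff assms(2))
  have "map_coeffs f (uv_monom a k l) = uv_monom (f a) k l" for a k l
    by (simp add: map_coeffs_def uv_monom_def map_poly_monom assms(1))
  then show ?thesis
    by (induction A rule: infinite_finite_induct) (simp_all add: add, simp_all add: map_coeffs_def)
qed

text \<open>Expand the product over subsets of \<open>A\<close> and group them by
  cardinality.\<close>

lemma sum_elem_sym:
  fixes x :: "nat \<Rightarrow> 'a::comm_ring_1"
  assumes "finite A" and "card A \<le> k"
  shows "(\<Sum>p = 0..k. elem_sym p x A * u ^ p) = (\<Prod>i\<in>A. 1 + x i * u)"
proof -
  have "(\<Prod>i\<in>A. 1 + x i * u) = (\<Prod>i\<in>A. x i * u + 1)"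
    by (simp add: add.commute)
  also have "\<dots> = (\<Sum>X\<in>Pow A. (\<Prod>i\<in>X. x i) * u ^ card X)"
    by (subst prod_add[OF assms(1)]) (simp add: prod.distrib)
  also have "\<dots> = (\<Sum>p = 0..k. \<Sum>X | X \<in> Pow A \<and> card X = p. (\<Prod>i\<in>X. x i) * u ^ card X)"
  proof (rule sum.group[symmetric])
    have "card X \<le> k" if "X \<subseteq> A" for X
      using card_mono[OF assms(1) that] assms(2) by linarith
    then show "card ` Pow A \<subseteq> {0..k}" by auto
  qed (use assms in auto)
  also have "\<dots> = (\<Sum>p = 0..k. elem_sym p x A * u ^ p)"
    by (intro sum.cong refl) (simp add: elem_sym_def sum_distrib_right)
  finally show ?thesis by simp
qed

section \<open>Localization in the field of rational functions\<close>

lemma to_fract_sum: "to_fract (\<Sum>i\<in>A. f i) = (\<Sum>i\<in>A. to_fract (f i))"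
  by (induction A rule: infinite_finite_induct) auto

lemma to_fract_prod: "to_fract (\<Prod>i\<in>A. f i) = (\<Prod>i\<in>A. to_fract (f i))"
  by (induction A rule: infinite_finite_induct) auto

lemma to_fract_elem_sym: "to_fract (elem_sym k x A) = elem_sym k (\<lambda>i. to_fract (x i)) A"
  by (simp add: elem_sym_def to_fract_sum to_fract_prod)

lemma to_fract_tvar_inv: "to_fract (tvar_inv i) = 1 / tfrac i"
proof -
  have "tfrac i * to_fract (tvar_inv i) = 1"
    unfolding tfrac_def by (simp only: to_fract_mult[symmetric] tvar_mult_inv to_fract_1)
  then show ?thesis using tfrac_nonzero[of i] by (simp add: field_simps)
qed

lemma tangent_factor_nonzero: "I \<subseteq> {1..n} \<Longrightarrow> to_fract (tangent_factor n I) \<noteq> 0"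
proof -
  assume "I \<subseteq> {1..n}"
  then have fin: "finite I" using finite_subset by blast
  have "1 - tvar_inv i * tvar j \<noteq> 0" if "i \<noteq> j" for i j
  proof
    assume "1 - tvar_inv i * tvar j = 0"
    then have "tvar i * (tvar_inv i * tvar j) = tvar i" by simp
    then have "tvar j = tvar i" by (simp add: tvar_mult_inv mult.assoc[symmetric])
    then show False using that by (simp add: tvar_eq_iff)
  qed
  then have "tangent_factor n I \<noteq> 0"
    using fin by (simp add: tangent_factor_def) (metis DiffD2)
  then show ?thesis by simp
qed

text \<open>The tangent factor in \<open>y_class\<close> cancels the denominator of the localization
  formula, and fixed points outside \<open>M\<close> drop out because the empty cone has Hilbert
  series 0.\<close>

lemma (in matroid_bases) pushforward_y_class:
  "pushforward n d (y_class n M * O1 * wedge_S p * wedge_Qdual n q)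
   = (\<Sum>I\<in>M. hilb (Cone M I) * (\<Prod>i\<in>I. tfrac i) * elem_sym p (\<lambda>i. 1 / tfrac i) I
       * elem_sym q tfrac ({1..n} - I))"
proof -
  let ?f = "\<lambda>I. hilb (Cone M I) * (\<Prod>i\<in>I. tfrac i) * elem_sym p (\<lambda>i. 1 / tfrac i) I
       * elem_sym q tfrac ({1..n} - I)"
  have "pushforward n d (y_class n M * O1 * wedge_S p * wedge_Qdual n q)
      = (\<Sum>I | I \<subseteq> {1..n} \<and> card I = d. ?f I)"
    unfolding pushforward_def
  proof (intro sum.cong refl)
    fix I assume "I \<in> {I. I \<subseteq> {1..n} \<and> card I = d}"
    then have "to_fract (tangent_factor n I) \<noteq> 0" by (intro tangent_factor_nonzero) simp
    then show "(y_class n M * O1 * wedge_S p * wedge_Qdual n q) I / to_fract (tangent_factor n I) = ?f I"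
      by (simp add: y_class_def O1_def wedge_S_def wedge_Qdual_def to_fract_prod to_fract_elem_sym
          to_fract_tvar_inv tfrac_def[symmetric])
  qed
  also have "\<dots> = (\<Sum>I\<in>M. ?f I)"
  proof (rule sum.mono_neutral_right)
    have "hilb (Cone M I) = 0" if "I \<notin> M" for I
      using that by (simp add: Cone_def hilb_empty)
    then show "\<forall>I\<in>{I. I \<subseteq> {1..n} \<and> card I = d} - M. ?f I = 0" by simp
  qed (use basisD in auto)
  finally show ?thesis .
qed

lemma pushforward_zero: "pushforward n d 0 = 0"
  by (simp add: pushforward_def)

lemma pushforward_add: "pushforward n d (f + g) = pushforward n d f + pushforward n d g"
  by (simp add: pushforward_def add_divide_distrib sum.distrib)

theorem theorem7p2:
  fixes n d :: nat and M :: "nat set set"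
  assumes "1 \<le> d" and "d \<le> n - 1"
    and "is_matroid n d M"
  shows "map_coeffs (pushforward n d)
           (\<Sum>p = 0..d. \<Sum>q = 0..n - d.
              uv_monom (y_class n M * O1 * wedge_S p * wedge_Qdual n q) p q)
       = map_coeffs to_fract
           (\<Sum>S\<in>Pow {1..n}.
              uv_monom (\<Prod>i\<in>S. tvar i) (d - rank_fn M S) (card S - rank_fn M S))"
    (is "?L = ?R")
proof (rule poly_poly_eqI)
  interpret matroid_bases n d M by (unfold_locales) fact
  show "infinite (UNIV :: ratfun set)"
    using finite_imageD[OF finite_subset[of "range tfrac" UNIV] tfrac_inj] by auto
  fix u v :: ratfun
  let ?h = "\<lambda>I. hilb (Cone M I) * (\<Prod>i\<in>I. tfrac i)"
  let ?a = "\<lambda>I p. elem_sym p (\<lambda>i. 1 / tfrac i) I * u ^ p"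
  let ?b = "\<lambda>I q. elem_sym q tfrac ({1..n} - I) * v ^ q"
  have L: "?L = (\<Sum>p = 0..d. \<Sum>q = 0..n - d.
      uv_monom (pushforward n d (y_class n M * O1 * wedge_S p * wedge_Qdual n q)) p q)"
    using map_coeffs_sum_uv_monom[of "pushforward n d"
        "\<lambda>(p, q). y_class n M * O1 * wedge_S p * wedge_Qdual n q" fst snd "{0..d} \<times> {0..n - d}"]
    by (simp add: pushforward_zero pushforward_add sum.cartesian_product case_prod_unfold)
  have "poly (poly ?L [:v:]) u = (\<Sum>p = 0..d. \<Sum>q = 0..n - d. \<Sum>I\<in>M. ?h I * (?a I p * ?b I q))"
    unfolding L poly_sum poly_uv_monom pushforward_y_class sum_distrib_right
    by (simp add: mult_ac)
  also have "\<dots> = (\<Sum>p = 0..d. \<Sum>I\<in>M. \<Sum>q = 0..n - d. ?h I * (?a I p * ?b I q))"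
    by (intro sum.cong refl sum.swap)
  also have "\<dots> = (\<Sum>I\<in>M. \<Sum>p = 0..d. \<Sum>q = 0..n - d. ?h I * (?a I p * ?b I q))"
    by (rule sum.swap)
  also have "\<dots> = (\<Sum>I\<in>M. ?h I * ((\<Sum>p = 0..d. ?a I p) * (\<Sum>q = 0..n - d. ?b I q)))"
    by (simp only: sum_product) (simp only: sum_distrib_left)
  also have "\<dots> = (\<Sum>I\<in>M. hilb (Cone M I)
      * ((\<Prod>i\<in>I. tfrac i + u) * (\<Prod>j\<in>{1..n} - I. 1 + v * tfrac j)))"
  proof (intro sum.cong refl)
    fix I assume "I \<in> M"
    note I = basisD[OF this]
    have a: "(\<Sum>p = 0..d. ?a I p) = (\<Prod>i\<in>I. 1 + 1 / tfrac i * u)"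
      using I by (intro sum_elem_sym) auto
    have b: "(\<Sum>q = 0..n - d. ?b I q) = (\<Prod>j\<in>{1..n} - I. 1 + tfrac j * v)"
      using I by (intro sum_elem_sym) (auto simp: card_Diff_subset)
    \<comment> \<open>The value of \<open>O1\<close> is absorbed factor by factor, turning
      \<open>1 + u / t_i\<close> into the weight \<open>t_i + u\<close> of a rank jump.\<close>
    have c: "(\<Prod>i\<in>I. tfrac i + u) = (\<Prod>i\<in>I. tfrac i) * (\<Prod>i\<in>I. 1 + 1 / tfrac i * u)"
      unfolding prod.distrib[symmetric] using tfrac_nonzero by (intro prod.cong) (auto simp: field_simps)
    show "?h I * ((\<Sum>p = 0..d. ?a I p) * (\<Sum>q = 0..n - d. ?b I q))
        = hilb (Cone M I) * ((\<Prod>i\<in>I. tfrac i + u) * (\<Prod>j\<in>{1..n} - I. 1 + v * tfrac j))"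
      unfolding a b c by (simp only: mult_ac)
  qed
  also have "\<dots> = (\<Sum>S\<in>Pow {1..n}. (\<Prod>i\<in>S. tfrac i) * u ^ (d - rank_fn M S) * v ^ (card S - rank_fn M S))"
    by (rule sum_hilb_Cone)
  also have "\<dots> = poly (poly ?R [:v:]) u"
    by (simp add: map_coeffs_sum_uv_monom poly_sum poly_uv_monom to_fract_prod tfrac_def)
  finally show "poly (poly ?L [:v:]) u = poly (poly ?R [:v:]) u" .
qed

end
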